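(* Let $X$ be a real Banach space and let $I_0\in\mathcal{I}$ be a closed non-degenerate interval in $\mathbb{R}^m$. Let $f:I_0\to X$ be a function and let $F:\mathcal{I}_{I_0}\to X$ be an additive interval function. Then $f$ is McShane integrable on $I_0$ with the primitive $F$ if and only if all of the following hold: (1) for each $\varepsilon>0$ there exists a gauge $\delta_\varepsilon$ on $(I_0)^{o}$ such that for each $\delta_\varepsilon$-fine $\mathcal{M}$-partition $\pi$ in $(I_0)^{o}$, $$\Big\|\sum_{(t,I)\in\pi}\big(f(t)|I|-F(I)\big)\Big\|<\varepsilon;$$ (2) $F$ is a Dunford-function; (3) $F$ has $\mathcal{M}$-negligible variation over $Z=I_0\setminus(I_0)^{o}$.
   Context: $\mathbb{R}^m$ carries the maximum norm; $B_m(t,r)$ is the open ball with center $t$ and radius $r>0$; $|A|$ is the Lebesgue measure of $A$; $E^{o}$ is the interior of $E$; $\mathbb{1}_A$ is the characteristic function of $A$. Intervals. A closed non-degenerate interval in $\mathbb{R}^m$ is a set $\prod_{j=1}^m[a_j,b_j]$ with $-\infty<a_j<b_j<+\infty$ for all $j$. $\mathcal{I}$ is the family of all of them, and $\mathcal{I}_E$ is the family of those contained in $E$. Intervals $I,J$ are non-overlapping if $I^{o}\cap J^{o}=\emptyset$. A function $F:\mathcal{I}_E\to X$ is an additive interval function if $F(I\cup J)=F(I)+F(J)$ whenever $I,J\in\mathcal{I}_E$ are non-overlapping and $I\cup J\in\mathcal{I}_E$. Partitions. An $\mathcal{M}$-partition in $E$ is a finite collection of pairs $(t_i,I_i)$,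 $i=1,\dots,p$, with $t_i\in E$, $I_i\in\mathcal{I}_E$ and the $I_i$ pairwise non-overlapping (it is not required that $t_i\in I_i$). It is an $\mathcal{M}$-partition of $E$ if also $\bigcup_i I_i=E$. It is $Z$-tagged if all $t_i\in Z$. A gauge on $Z$ is a function $\delta:Z\to(0,+\infty)$; a partition with tags in the domain of $\delta$ is $\delta$-fine if $I_i\subset B_m(t_i,\delta(t_i))$ for all $i$. McShane integral. For $W\in\mathcal{I}$, $f:W\to X$ is McShane integrable on $W$ if there is $x_f\in X$ such that for every $\varepsilon>0$ there is a gauge $\delta$ on $W$ with $\|\sum_{(t,I)\in\pi}f(t)|I|-x_f\|<\varepsilon$ for every $\delta$-fine $\mathcal{M}$-partition $\pi$ of $W$; then $(M)\int_W f\,d\lambda=x_f$. In this case $f\cdot\mathbb{1}_A$ is McShane integrable on $W$ for every Lebesgue measurable $A\subset W$, with integral denoted $(M)\int_A f\,d\lambda$, and the primitive of $f$ is the additive interval function $\mathcal{I}_W\to X$, $I\mapsto (M)\int_I f\,d\lambda$. Divisions. Let $E\subset\mathbb{R}^m$ be bounded and Lebesgue measurable with $E^{o}\neq\emptyset$. $\mathscr{P}_E$ is the family of all divisions in $E$, i.e. sequences $(I_k)_{k\ge1}$ of pairwise non-overlapping intervals in $\mathcal{I}_E$. $\mathscr{D}_E$ is the family of all divisions of $E$, i.e. those $(I_k)\in\mathscr{P}_E$ with $E=\bigcup_{k=1}^{\infty}I_k$. (The same notation is used for $E^{o}$.) Dunford-function. An additive interval function $F:\mathcal{I}_E\to X$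 is a Dunford-function if for every $(I_k)\in\mathscr{P}_E$: (a) the series $\sum_{k:|I\cap I_k|>0}F(I\cap I_k)$ is unconditionally convergent in $X$ for each $I\in\mathcal{I}$; and (b) if $(I_k)\in\mathscr{D}_{E^{o}}$, then $F(I)=\sum_{k:|I\cap I_k|>0}F(I\cap I_k)$ for all $I\in\mathcal{I}_E$. Negligible variation. An additive interval function $F:\mathcal{I}_E\to X$ has $\mathcal{M}$-negligible variation over (on) $Z\subset\mathbb{R}^m$ if for each $\varepsilon>0$ there is a gauge $\delta_\varepsilon$ on $Z$ such that for each $Z$-tagged $\delta_\varepsilon$-fine $\mathcal{M}$-partition $\pi$ in $\mathbb{R}^m$ and every $(I_k)\in\mathscr{D}_{E^{o}}$: the series $\sum_{k:|I\cap I_k|>0}F(I\cap I_k)$ is unconditionally convergent in $X$ for each $(t,I)\in\pi$, and $\big\|\sum_{(t,I)\in\pi}\big(\sum_{k:|I\cap I_k|>0}F(I\cap I_k)\big)\big\|<\varepsilon$. Here these notions are applied with $E=I_0$. *)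

theory Defs
  imports "HOL-Analysis.Analysis"
begin

text \<open>
  The space \<open>\<real>\<^sup>m\<close> is \<open>real ^ 'm\<close>.  Its library norm is the Euclidean one, so balls for the
  maximum norm are expressed through \<^const>\<open>infnorm\<close>.  Functions that are only
  given on a subset (point functions, gauges, interval functions) are total functions here; all
  definitions below look at them only on the intended domain.
\<close>

definition max_ball :: "real ^ 'm \<Rightarrow> real \<Rightarrow> (real ^ 'm) set" where
  "max_ball t r = {s. infnorm (s - t) < r}"

definition intervals :: "(real ^ 'm) set set" where
  "intervals = {cbox a b | a b. \<forall>j. a $ j < b $ j}"

definition intervals_in :: "(real ^ 'm) set \<Rightarrow> (real ^ 'm) set set" where
  "intervals_in E = {I \<in> intervals. I \<subseteq> E}"

definition nonoverlapping :: "(real ^ 'm) set \<Rightarrow> (real ^ 'm) set \<Rightarrow> bool" where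
  "nonoverlapping I J \<longleftrightarrow> interior I \<inter> interior J = {}"

definition additive_interval_function ::
    "(real ^ 'm) set \<Rightarrow> ((real ^ 'm) set \<Rightarrow> 'x::real_normed_vector) \<Rightarrow> bool" where
  "additive_interval_function E F \<longleftrightarrow>
     (\<forall>I \<in> intervals_in E. \<forall>J \<in> intervals_in E.
        nonoverlapping I J \<and> I \<union> J \<in> intervals_in E \<longrightarrow> F (I \<union> J) = F I + F J)"

text \<open>
  Non-overlapping intervals with non-empty interior are distinct, so a finite
  collection of pairs with pairwise non-overlapping intervals is the same thing as a finite set
  of pairs.  The tag need not belong to the interval.
\<close>

definition M_partition_in :: "(real ^ 'm) set \<Rightarrow> ((real ^ 'm) \<times> (real ^ 'm) set) set \<Rightarrow> bool" where
  "M_partition_in E \<pi> \<longleftrightarrow>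
     finite \<pi> \<and> (\<forall>(t, I) \<in> \<pi>. t \<in> E \<and> I \<in> intervals_in E) \<and>
     (\<forall>p \<in> \<pi>. \<forall>q \<in> \<pi>. p \<noteq> q \<longrightarrow> nonoverlapping (snd p) (snd q))"

definition M_partition_of :: "(real ^ 'm) set \<Rightarrow> ((real ^ 'm) \<times> (real ^ 'm) set) set \<Rightarrow> bool" where
  "M_partition_of E \<pi> \<longleftrightarrow> M_partition_in E \<pi> \<and> (\<Union>(t, I) \<in> \<pi>. I) = E"

definition tagged_in :: "(real ^ 'm) set \<Rightarrow> ((real ^ 'm) \<times> (real ^ 'm) set) set \<Rightarrow> bool" where
  "tagged_in Z \<pi> \<longleftrightarrow> (\<forall>(t, I) \<in> \<pi>. t \<in> Z)"

definition gauge_on :: "(real ^ 'm) set \<Rightarrow> (real ^ 'm \<Rightarrow> real) \<Rightarrow> bool" where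
  "gauge_on Z \<delta> \<longleftrightarrow> (\<forall>t \<in> Z. 0 < \<delta> t)"

definition delta_fine :: "(real ^ 'm \<Rightarrow> real) \<Rightarrow> ((real ^ 'm) \<times> (real ^ 'm) set) set \<Rightarrow> bool" where
  "delta_fine \<delta> \<pi> \<longleftrightarrow> (\<forall>(t, I) \<in> \<pi>. I \<subseteq> max_ball t (\<delta> t))"

definition has_mcshane_integral ::
    "(real ^ 'm \<Rightarrow> 'x::real_normed_vector) \<Rightarrow> 'x \<Rightarrow> (real ^ 'm) set \<Rightarrow> bool" where
  "has_mcshane_integral f x W \<longleftrightarrow>
     (\<forall>\<epsilon>>0. \<exists>\<delta>. gauge_on W \<delta> \<and>
        (\<forall>\<pi>. M_partition_of W \<pi> \<and> delta_fine \<delta> \<pi> \<longrightarrow>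
           norm ((\<Sum>(t, I)\<in>\<pi>. measure lebesgue I *\<^sub>R f t) - x) < \<epsilon>))"

definition mcshane_integrable ::
    "(real ^ 'm \<Rightarrow> 'x::real_normed_vector) \<Rightarrow> (real ^ 'm) set \<Rightarrow> bool" where
  "mcshane_integrable f W \<longleftrightarrow> (\<exists>x. has_mcshane_integral f x W)"

text \<open>
  The integral of \<open>f\<close> over \<open>I \<subseteq> W\<close> is the integral over \<open>W\<close> of \<open>f\<close> times the characteristic
  function of \<open>I\<close>.
\<close>

definition mcshane_integrable_with_primitive ::
    "(real ^ 'm \<Rightarrow> 'x::real_normed_vector) \<Rightarrow> (real ^ 'm) set \<Rightarrow>
     ((real ^ 'm) set \<Rightarrow> 'x) \<Rightarrow> bool" where
  "mcshane_integrable_with_primitive f W F \<longleftrightarrow>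
     mcshane_integrable f W \<and>
     (\<forall>I \<in> intervals_in W. has_mcshane_integral (\<lambda>t. indicator I t *\<^sub>R f t) (F I) W)"

definition divisions_in :: "(real ^ 'm) set \<Rightarrow> (nat \<Rightarrow> (real ^ 'm) set) set" where
  "divisions_in E =
     {D. (\<forall>k. D k \<in> intervals_in E) \<and> (\<forall>j k. j \<noteq> k \<longrightarrow> nonoverlapping (D j) (D k))}"

definition divisions_of :: "(real ^ 'm) set \<Rightarrow> (nat \<Rightarrow> (real ^ 'm) set) set" where
  "divisions_of E = {D \<in> divisions_in E. (\<Union>k. D k) = E}"

definition hits :: "(nat \<Rightarrow> (real ^ 'm) set) \<Rightarrow> (real ^ 'm) set \<Rightarrow> nat set" where
  "hits D I = {k. measure lebesgue (I \<inter> D k) > 0}"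

text \<open>
  Unconditional convergence of a series is \<^const>\<open>summable_on\<close>: convergence of the net of sums
  over finite index sets, which does not depend on any order of the terms.
\<close>

definition dunford_function ::
    "(real ^ 'm) set \<Rightarrow> ((real ^ 'm) set \<Rightarrow> 'x::banach) \<Rightarrow> bool" where
  "dunford_function E F \<longleftrightarrow>
     additive_interval_function E F \<and>
     (\<forall>D \<in> divisions_in E.
        (\<forall>I \<in> intervals. (\<lambda>k. F (I \<inter> D k)) summable_on hits D I) \<and>
        (D \<in> divisions_of (interior E) \<longrightarrow>
           (\<forall>I \<in> intervals_in E. F I = (\<Sum>\<^sub>\<infinity>k\<in>hits D I. F (I \<inter> D k)))))"

definition M_negligible_variation ::
    "(real ^ 'm) set \<Rightarrow> ((real ^ 'm) set \<Rightarrow> 'x::banach) \<Rightarrow> (real ^ 'm) set \<Rightarrow> bool" where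
  "M_negligible_variation E F Z \<longleftrightarrow>
     (\<forall>\<epsilon>>0. \<exists>\<delta>. gauge_on Z \<delta> \<and>
        (\<forall>\<pi>. M_partition_in UNIV \<pi> \<and> tagged_in Z \<pi> \<and> delta_fine \<delta> \<pi> \<longrightarrow>
           (\<forall>D \<in> divisions_of (interior E).
              (\<forall>(t, I) \<in> \<pi>. (\<lambda>k. F (I \<inter> D k)) summable_on hits D I) \<and>
              norm (\<Sum>(t, I)\<in>\<pi>. \<Sum>\<^sub>\<infinity>k\<in>hits D I. F (I \<inter> D k)) < \<epsilon>)))"

end

theory Submission
  imports Defs
begin

text \<open>
  Both sides are equivalent to the Saks--Henstock estimate on all of \<open>I\<^sub>0\<close>: for a suitable gauge,
  \<open>\<parallel>\<Sum> (|I| f(t) - F(I))\<parallel> < \<epsilon>\<close> for every fine partial partition in \<open>I\<^sub>0\<close>.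

  The estimate makes \<open>F\<close> absolutely continuous with respect to Lebesgue measure, hence (2), and (3)
  because the boundary is a null set.  Conversely, (1) is the estimate for partitions in the
  interior, and a gauge can be chosen so that every pair of a fine partition either lies in the
  interior or is tagged on the boundary; for the latter, the sum of the \<open>|I| f(t)\<close> is small by
  nullity of the boundary and the sum of the \<open>F(I)\<close> is small by (2) and (3).
\<close>

section \<open>Finite families of boxes\<close>

text \<open>In a Banach space the estimate controls the norm of a sum, not the sum of the norms of
  its terms. Whole families are therefore kept together throughout, and convergence is derived from
  norms of finite sums, which yields unconditional convergence. The combinatorial obstacle is that
  cutting boxes by boxes produces empty, flat and repeated flat pieces, while partitions consist of
  non-degenerate intervals and \<open>F\<close> has a meaning only on such intervals inside
  \<open>I0\<close>. Two devices absorb this. A \<open>box_family\<close> is indexed, so its pieces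
  may be degenerate or repeat when they are; and \<open>zero_ext\<close> turns \<open>F\<close> into
  a function of all boxes that is \<open>operative\<close> in the sense of the library, just as
  Lebesgue measure is. One additivity lemma then serves both, and
  \<open>box_family_partition\<close> leads back to genuine partitions. The primitive is defined by
  multiplying \<open>f\<close> with an indicator, the estimate by evaluating \<open>F\<close> on
  pieces of intervals. The two are joined by a gauge argument at the null boundary of the cutting
  box.\<close>

definition box_family :: "'i set \<Rightarrow> ('i \<Rightarrow> (real ^ 'm) set) \<Rightarrow> bool" where
  "box_family A K \<longleftrightarrow> finite A \<and> (\<forall>i\<in>A. \<exists>a b. K i = cbox a b) \<and>
     pairwise (\<lambda>i j. interior (K i) \<inter> interior (K j) = {}) A"

lemma box_familyD:
  assumes "box_family A K"
  shows "finite A"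
    and "\<And>i. i \<in> A \<Longrightarrow> \<exists>a b. K i = cbox a b"
    and "\<And>i j. i \<in> A \<Longrightarrow> j \<in> A \<Longrightarrow> i \<noteq> j \<Longrightarrow> interior (K i) \<inter> interior (K j) = {}"
  using assms unfolding box_family_def pairwise_def by blast+

lemma intervals_iff: "I \<in> intervals \<longleftrightarrow> (\<exists>a b. I = cbox a b) \<and> interior I \<noteq> {}"
  for I :: "(real ^ 'm) set"
proof -
  have "box a b = {} \<longleftrightarrow> \<not> (\<forall>j. a $ j < b $ j)" for a b :: "real ^ 'm"
    by (auto simp: box_eq_empty Basis_vec_def inner_axis not_less)
  then show ?thesis
    unfolding intervals_def by (simp add: interior_cbox) (metis interior_cbox)
qed

lemma intervals_inI: "\<exists>a b. I = cbox a b \<Longrightarrow> interior I \<noteq> {} \<Longrightarrow> I \<subseteq> W \<Longrightarrow> I \<in> intervals_in W"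
  unfolding intervals_in_def intervals_iff by simp

lemma intervals_inD:
  assumes "I \<in> intervals_in W"
  shows "\<exists>a b. I = cbox a b" "interior I \<noteq> {}" "I \<subseteq> W"
  using assms unfolding intervals_in_def intervals_iff by simp_all

lemma measure_box_eq_0:
  fixes a b :: "real ^ 'm"
  shows "measure lebesgue (cbox a b) = 0 \<longleftrightarrow> interior (cbox a b) = {}"
  using content_eq_0_interior[of a b] by (simp add: measure_completion)

lemma box_family_subset: "box_family A K \<Longrightarrow> B \<subseteq> A \<Longrightarrow> box_family B K"
  unfolding box_family_def by (meson finite_subset pairwise_mono subset_iff)

lemma box_family_Int_box:
  assumes "box_family A K"
  shows "box_family A (\<lambda>i. cbox c d \<inter> K i)"
  unfolding box_family_def pairwise_def
proof (intro conjI ballI impI)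
  show "\<exists>u v. cbox c d \<inter> K i = cbox u v" if "i \<in> A" for i
    using box_familyD(2)[OF assms that] Int_interval[of c d] by blast
  show "finite A" using assms by (rule box_familyD)
  show "interior (cbox c d \<inter> K i) \<inter> interior (cbox c d \<inter> K j) = {}"
    if "i \<in> A" "j \<in> A" "i \<noteq> j" for i j
    using box_familyD(3)[OF assms that] by auto
qed

lemma M_partition_in_box_family: "M_partition_in E \<pi> \<Longrightarrow> box_family \<pi> snd"
  unfolding M_partition_in_def box_family_def pairwise_def nonoverlapping_def intervals_in_def
  by (auto simp: intervals_iff split: prod.splits)

lemma M_partition_in_mono: "M_partition_in E \<pi> \<Longrightarrow> E \<subseteq> E' \<Longrightarrow> M_partition_in E' \<pi>"
  unfolding M_partition_in_def intervals_in_def by fast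

lemma M_partition_in_restrict:
  assumes "M_partition_in E \<pi>" "\<And>x. x \<in> \<pi> \<Longrightarrow> fst x \<in> E'" "\<And>x. x \<in> \<pi> \<Longrightarrow> snd x \<subseteq> E'"
  shows "M_partition_in E' \<pi>"
  using assms unfolding M_partition_in_def intervals_in_def case_prod_unfold by simp

lemma M_partition_in_subset: "M_partition_in E \<pi> \<Longrightarrow> \<rho> \<subseteq> \<pi> \<Longrightarrow> M_partition_in E \<rho>"
  unfolding M_partition_in_def by (meson finite_subset subset_iff)

lemma delta_fineD: "delta_fine \<delta> \<pi> \<Longrightarrow> x \<in> \<pi> \<Longrightarrow> snd x \<subseteq> max_ball (fst x) (\<delta> (fst x))"
  unfolding delta_fine_def by (cases x) auto

lemma delta_fine_subset: "delta_fine \<delta> \<pi> \<Longrightarrow> \<rho> \<subseteq> \<pi> \<Longrightarrow> delta_fine \<delta> \<rho>"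
  unfolding delta_fine_def by blast

lemma delta_fine_mono:
  "delta_fine \<delta> \<pi> \<Longrightarrow> (\<And>t I. (t, I) \<in> \<pi> \<Longrightarrow> \<delta> t \<le> \<delta>' t) \<Longrightarrow> delta_fine \<delta>' \<pi>"
  unfolding delta_fine_def max_ball_def by fastforce

lemma box_family_division:
  assumes "box_family A K"
  shows "(K ` A - {{}}) division_of (\<Union>i\<in>A. K i)"
proof (rule division_ofI)
  fix L L' assume "L \<in> K ` A - {{}}" "L' \<in> K ` A - {{}}" "L \<noteq> L'"
  then show "interior L \<inter> interior L' = {}"
    using box_familyD(3)[OF assms] by blast
qed (use box_familyD(1,2)[OF assms] in auto)

text \<open>Passing to the image loses nothing: distinct indices with the same box force that box to
  have empty interior, and an operative function vanishes on it.\<close>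

lemma operative_sum_image:
  fixes g :: "(real ^ 'm) set \<Rightarrow> 'x::ab_group_add"
  assumes "operative (+) 0 g" and fam: "box_family A K"
  shows "sum g (K ` A - {{}}) = (\<Sum>i\<in>A. g (K i))"
proof -
  interpret operative "(+)" "0::'x" g by (fact assms(1))
  note fin = box_familyD(1)[OF fam]
  have zero: "g (K i) = 0" if "i \<in> A" "interior (K i) = {}" for i
    using box_familyD(2)[OF fam that(1)] that(2) box_empty_imp by (metis interior_cbox)
  have "sum g (K ` A - {{}}) = sum g (K ` A)"
    using fin by (intro sum.mono_neutral_left) auto
  also have "\<dots> = sum (g \<circ> K) A"
  proof (rule sum.reindex_nontrivial[OF fin])
    fix i j assume ij: "i \<in> A" "j \<in> A" "i \<noteq> j" "K i = K j"
    then have "interior (K i) = {}" using box_familyD(3)[OF fam ij(1-3)] by simp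
    then show "g (K i) = 0" by (rule zero[OF ij(1)])
  qed
  finally show ?thesis by simp
qed

lemma operative_box_family:
  fixes g :: "(real ^ 'm) set \<Rightarrow> 'x::ab_group_add"
  assumes g: "operative (+) 0 g" and K: "box_family A K" and sub: "cbox c d \<subseteq> (\<Union>i\<in>A. K i)"
  shows "(\<Sum>i\<in>A. g (cbox c d \<inter> K i)) = g (cbox c d)"
proof -
  interpret operative "(+)" "0::'x" g by (fact g)
  let ?L = "\<lambda>i. cbox c d \<inter> K i"
  have fam: "box_family A ?L" using K by (rule box_family_Int_box)
  have "(\<Union>i\<in>A. ?L i) = cbox c d" using sub by auto
  then have "(?L ` A - {{}}) division_of cbox c d"
    using box_family_division[OF fam] by simp
  then have "sum g (?L ` A - {{}}) = g (cbox c d)"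
    using division by (simp add: sum_def)
  then show ?thesis using operative_sum_image[OF g fam] by simp
qed

text \<open>A partial division of a box extends to a full one. The added boxes \<open>R\<close>
  serve as a finite remainder when \<open>F\<close> of a box is compared with a partial sum over
  pieces of it.\<close>

lemma box_family_complement:
  fixes K :: "'i \<Rightarrow> (real ^ 'm) set"
  assumes "box_family A K" "\<And>i. i \<in> A \<Longrightarrow> K i \<subseteq> cbox c d"
  obtains R where "box_family R (\<lambda>L. L)" "\<And>L. L \<in> R \<Longrightarrow> L \<subseteq> cbox c d"
    "(K ` A - {{}}) \<inter> R = {}" "(K ` A - {{}}) \<union> R division_of cbox c d"
proof -
  let ?p = "K ` A - {{}}"
  have "\<Union>?p = (\<Union>i\<in>A. K i)" by blast
  then have "?p division_of \<Union>?p" using box_family_division[OF assms(1)] by metis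
  moreover have "\<Union>?p \<subseteq> cbox c d" using assms(2) by blast
  ultimately obtain q where q: "?p \<subseteq> q" "q division_of cbox c d"
    by (rule partial_division_extend_interval)
  note qD = division_ofD[OF q(2)]
  show ?thesis
  proof (rule that)
    show "box_family (q - ?p) (\<lambda>L. L)"
      unfolding box_family_def pairwise_def using qD(1,4,5) by blast
    show "L \<subseteq> cbox c d" if "L \<in> q - ?p" for L using qD(2) that by blast
    show "?p \<union> (q - ?p) division_of cbox c d" using q by (simp add: Un_absorb1)
  qed blast
qed

lemma operative_complement:
  fixes g :: "(real ^ 'm) set \<Rightarrow> 'x::ab_group_add"
  assumes g: "operative (+) 0 g" and K: "box_family A K"
    and R: "(K ` A - {{}}) \<inter> R = {}" "(K ` A - {{}}) \<union> R division_of cbox c d"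
  shows "g (cbox c d) = (\<Sum>i\<in>A. g (K i)) + (\<Sum>L\<in>R. g L)"
proof -
  interpret operative "(+)" "0::'x" g by (fact g)
  have "finite (K ` A - {{}})" "finite R" using division_ofD(1)[OF R(2)] by auto
  from sum.union_disjoint[OF this R(1), of g] show ?thesis
    using division[OF R(2)] operative_sum_image[OF g K] by (simp add: sum_def)
qed

text \<open>Two pieces differ either in the outer index, and then the \<open>K\<close> parts
  separate them, or in the inner one, and then the \<open>L\<close> parts do. The inner family may
  depend on the outer index, so that each box can be cut by a partition of its own.\<close>

lemma box_family_Sigma:
  assumes A: "box_family A K" and B: "\<And>i. i \<in> A \<Longrightarrow> box_family (B i) (L i)"
  shows "box_family (Sigma A B) (\<lambda>(i, x). K i \<inter> L i x)"
  unfolding box_family_def pairwise_def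
proof (intro conjI ballI impI)
  show "finite (Sigma A B)" using box_familyD(1)[OF A] box_familyD(1)[OF B] by (rule finite_SigmaI)
  fix u assume u: "u \<in> Sigma A B"
  then obtain i x where ix: "u = (i, x)" "i \<in> A" "x \<in> B i" by blast
  obtain c d where "K i = cbox c d" using box_familyD(2)[OF A ix(2)] by blast
  then show "\<exists>a b. (case u of (i, x) \<Rightarrow> K i \<inter> L i x) = cbox a b"
    using box_familyD(2)[OF box_family_Int_box[OF B[OF ix(2)]] ix(3)] by (simp add: ix(1))
  fix v assume v: "v \<in> Sigma A B" and "u \<noteq> v"
  then obtain j y where jy: "v = (j, y)" "j \<in> A" "y \<in> B j" by blast
  have "interior (K i) \<inter> interior (K j) = {} \<or> interior (L i x) \<inter> interior (L j y) = {}"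
  proof (cases "i = j")
    case True
    then show ?thesis
      using box_familyD(3)[OF B[OF ix(2)] ix(3)] jy(3) \<open>u \<noteq> v\<close> ix(1) jy(1) by blast
  next
    case False
    then show ?thesis using box_familyD(3)[OF A ix(2) jy(2)] by blast
  qed
  then show "interior (case u of (i, x) \<Rightarrow> K i \<inter> L i x) \<inter>
      interior (case v of (i, x) \<Rightarrow> K i \<inter> L i x) = {}"
    by (auto simp: ix(1) jy(1))
qed

section \<open>Measure of box families and passage to partitions\<close>

lemma operative_measure_lebesgue: "operative (+) 0 (measure lebesgue :: (real ^ 'm) set \<Rightarrow> real)"
proof
  show "measure lebesgue (cbox a b) = 0" if "box a b = {}" for a b :: "real ^ 'm"
    using that by (simp only: measure_box_eq_0 interior_cbox)
  show "measure lebesgue (cbox a b) =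
      measure lebesgue (cbox a b \<inter> {x. x \<bullet> k \<le> c}) + measure lebesgue (cbox a b \<inter> {x. x \<bullet> k \<ge> c})"
    if "k \<in> Basis" for a b k :: "real ^ 'm" and c
    using content_split[OF that, of a b c] that by (simp add: interval_split measure_completion)
qed

text \<open>Two boxes with disjoint interiors meet in a convex set with empty interior, which is a
  null set.\<close>

lemma box_family_measure_Union:
  assumes "box_family A K"
  shows "measure lebesgue (\<Union>i\<in>A. K i) = (\<Sum>i\<in>A. measure lebesgue (K i))"
proof (rule measure_negligible_finite_Union_image)
  show "finite A" using assms by (rule box_familyD)
  show "K i \<in> lmeasurable" if "i \<in> A" for i
    using box_familyD(2)[OF assms that] by auto
  have "negligible (K i \<inter> K j)" if "i \<in> A" "j \<in> A" "i \<noteq> j" for i j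
  proof -
    have "convex (K i \<inter> K j)"
      using assms that unfolding box_family_def by (metis convex_Int convex_box(1))
    moreover have "interior (K i \<inter> K j) = {}"
      using assms that unfolding box_family_def pairwise_def by simp
    ultimately show ?thesis by (simp add: negligible_convex_interior)
  qed
  then show "pairwise (\<lambda>i j. negligible (K i \<inter> K j)) A" by (simp add: pairwise_def)
qed

lemma box_family_measure_le:
  assumes "box_family A K" "\<And>i. i \<in> A \<Longrightarrow> K i \<subseteq> S" "S \<in> lmeasurable"
  shows "(\<Sum>i\<in>A. measure lebesgue (K i)) \<le> measure lebesgue S"
proof -
  have "(\<Union>i\<in>A. K i) \<in> sets lebesgue"
    using box_familyD(1,2)[OF assms(1)] by (intro sets.finite_UN) fastforce+
  then show ?thesis
    using assms by (subst box_family_measure_Union[symmetric])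
      (auto intro: measure_mono_fmeasurable)
qed

text \<open>Degenerate pieces are discarded to obtain a genuine partition; the hypothesis on
  \<open>h\<close> says that the sum does not notice. In the last clause, a division of a
  non-degenerate box still covers it once its members of measure zero are gone; for a flat box
  nothing would remain.\<close>

lemma box_family_partition:
  fixes K :: "'i \<Rightarrow> (real ^ 'm) set" and h :: "real ^ 'm \<Rightarrow> (real ^ 'm) set \<Rightarrow> 'x::comm_monoid_add"
  assumes K: "box_family A K"
    and sub: "\<And>i. i \<in> A \<Longrightarrow> t i \<in> E \<and> K i \<subseteq> E \<and> K i \<subseteq> max_ball (t i) (\<delta> (t i))"
    and h: "\<And>i. i \<in> A \<Longrightarrow> interior (K i) = {} \<Longrightarrow> h (t i) (K i) = 0"
  obtains \<pi> where "M_partition_in E \<pi>" "delta_fine \<delta> \<pi>"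
    "(\<Sum>(s, I)\<in>\<pi>. h s I) = (\<Sum>i\<in>A. h (t i) (K i))"
    "\<And>a b. (\<Union>i\<in>A. K i) = cbox a b \<Longrightarrow> box a b \<noteq> {} \<Longrightarrow> (\<Union>(s, I)\<in>\<pi>. I) = cbox a b"
proof
  define B where "B = {i \<in> A. interior (K i) \<noteq> {}}"
  define \<pi> where "\<pi> = (\<lambda>i. (t i, K i)) ` B"
  have fin: "finite A" and box: "\<And>i. i \<in> A \<Longrightarrow> \<exists>a b. K i = cbox a b"
    and disj: "\<And>i j. i \<in> A \<Longrightarrow> j \<in> A \<Longrightarrow> i \<noteq> j \<Longrightarrow> interior (K i) \<inter> interior (K j) = {}"
    using K unfolding box_family_def pairwise_def by auto
  have inj: "inj_on K B"
  proof (rule inj_onI, rule ccontr)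
    fix i j assume "i \<in> B" "j \<in> B" "K i = K j" "i \<noteq> j"
    then show False using disj[of i j] by (simp add: B_def)
  qed
  show "M_partition_in E \<pi>"
    unfolding M_partition_in_def
  proof (intro conjI ballI impI)
    show "finite \<pi>" using fin by (simp add: \<pi>_def B_def)
    show "case p of (s, I) \<Rightarrow> s \<in> E \<and> I \<in> intervals_in E" if "p \<in> \<pi>" for p
      using that sub box by (auto simp: \<pi>_def B_def intervals_in_def intervals_iff)
    show "nonoverlapping (snd p) (snd q)" if "p \<in> \<pi>" "q \<in> \<pi>" "p \<noteq> q" for p q
    proof -
      from that obtain i j where "i \<in> A" "p = (t i, K i)" "j \<in> A" "q = (t j, K j)"
        unfolding \<pi>_def B_def by blast
      then show ?thesis using disj[of i j] \<open>p \<noteq> q\<close> by (auto simp: nonoverlapping_def)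
    qed
  qed
  show "delta_fine \<delta> \<pi>"
    unfolding delta_fine_def \<pi>_def B_def using sub by auto
  have "(\<Sum>(s, I)\<in>\<pi>. h s I) = (\<Sum>i\<in>B. h (t i) (K i))"
    unfolding \<pi>_def using inj by (subst sum.reindex) (auto simp: inj_on_def)
  also have "\<dots> = (\<Sum>i\<in>A. h (t i) (K i))"
    using fin h by (intro sum.mono_neutral_left) (auto simp: B_def)
  finally show "(\<Sum>(s, I)\<in>\<pi>. h s I) = (\<Sum>i\<in>A. h (t i) (K i))" .
  show "(\<Union>(s, I)\<in>\<pi>. I) = cbox a b" if un: "(\<Union>i\<in>A. K i) = cbox a b" and "box a b \<noteq> {}" for a b
  proof -
    let ?D = "K ` A - {{}}"
    have "?D division_of cbox a b" using box_family_division[OF K] un by simp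
    moreover have "measure lborel (cbox a b) \<noteq> 0" using that by (simp add: content_eq_0_interior)
    ultimately have "{k \<in> ?D. measure lborel k \<noteq> 0} division_of cbox a b"
      by (rule division_of_nontrivial)
    then have "\<Union>{k \<in> ?D. measure lborel k \<noteq> 0} = cbox a b" by auto
    moreover have "measure lborel (K i) = 0 \<longleftrightarrow> interior (K i) = {}" if "i \<in> A" for i
      using box[OF that] content_eq_0_interior by metis
    then have "{k \<in> ?D. measure lborel k \<noteq> 0} = K ` B"
      by (auto simp: B_def)
    ultimately show ?thesis by (auto simp: \<pi>_def)
  qed
qed

section \<open>Gauges and null sets\<close>

lemma open_max_ball: "open (max_ball t r)"
  unfolding max_ball_def by (intro open_Collect_less continuous_intros)

lemma center_in_max_ball: "0 < r \<Longrightarrow> t \<in> max_ball t r"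
  unfolding max_ball_def by (simp add: infnorm_0)

lemma max_ball_mono: "r \<le> r' \<Longrightarrow> max_ball t r \<subseteq> max_ball t r'"
  unfolding max_ball_def by auto

text \<open>Open sets come from the Euclidean norm, and \<open>norm\<close> is at most
  \<open>sqrt DIM\<close> times \<open>infnorm\<close>; hence the radius
  \<open>e / ?D\<close>.\<close>

lemma max_ball_in_open:
  fixes t :: "real ^ 'm"
  assumes "open S" "t \<in> S"
  shows "\<exists>r>0. max_ball t r \<subseteq> S"
proof -
  obtain e where e: "e > 0" "ball t e \<subseteq> S" using assms open_contains_ball by blast
  let ?D = "sqrt DIM(real ^ 'm)"
  have D: "?D > 0" by simp
  have "s \<in> ball t e" if "s \<in> max_ball t (e / ?D)" for s
  proof -
    have "norm (s - t) \<le> ?D * infnorm (s - t)" by (rule norm_le_infnorm)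
    also have "\<dots> < ?D * (e / ?D)"
      using that D unfolding max_ball_def by (intro mult_strict_left_mono) auto
    finally show ?thesis using D by (simp add: dist_norm norm_minus_commute)
  qed
  moreover have "e / ?D > 0" using e D by simp
  ultimately show ?thesis using e by blast
qed

text \<open>Cousin's lemma: the library supplies a fine tagged division with tags inside their
  intervals, which is a special case of a McShane partition after the flat members are
  dropped.\<close>

lemma fine_M_partition_exists:
  fixes a b :: "real ^ 'm"
  assumes "box a b \<noteq> {}" and \<delta>: "gauge_on (cbox a b) \<delta>"
  obtains \<pi> where "M_partition_of (cbox a b) \<pi>" "delta_fine \<delta> \<pi>"
proof -
  \<comment> \<open>A library gauge assigns an open neighbourhood to every point of the space, while
    \<delta> is positive only on the box; \<open>UNIV\<close> is the default outside.\<close>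
  define \<gamma> where "\<gamma> t = (if t \<in> cbox a b then max_ball t (\<delta> t) else UNIV)" for t
  have "gauge \<gamma>"
    using \<delta> by (auto simp: gauge_def \<gamma>_def open_max_ball center_in_max_ball gauge_on_def)
  then obtain p where p: "p tagged_division_of cbox a b" "\<gamma> fine p"
    by (rule fine_division_exists)
  have "box_family p snd"
    unfolding box_family_def pairwise_def using tagged_division_ofD(1,4,5)[OF p(1)] by fastforce
  moreover have "fst x \<in> cbox a b \<and> snd x \<subseteq> cbox a b \<and> snd x \<subseteq> max_ball (fst x) (\<delta> (fst x))"
    if "x \<in> p" for x
  proof -
    obtain t K where x: "x = (t, K)" by (cases x)
    then have "t \<in> cbox a b" "K \<subseteq> cbox a b"
      using tagged_division_ofD(2,3)[OF p(1)] that by blast+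
    moreover have "K \<subseteq> \<gamma> t" using p(2) that x by (auto simp: fine_def)
    ultimately show ?thesis by (simp add: x \<gamma>_def)
  qed
  ultimately obtain \<pi> where \<pi>: "M_partition_in (cbox a b) \<pi>" "delta_fine \<delta> \<pi>"
    "\<And>u v. (\<Union>i\<in>p. snd i) = cbox u v \<Longrightarrow> box u v \<noteq> {} \<Longrightarrow> (\<Union>(s, I)\<in>\<pi>. I) = cbox u v"
    by (rule box_family_partition[where h = "\<lambda>_ _. 0::nat" and t = fst]) auto
  have "(\<Union>i\<in>p. snd i) = cbox a b"
    using tagged_division_ofD(6)[OF p(1)] by force
  then have "M_partition_of (cbox a b) \<pi>"
    unfolding M_partition_of_def using \<pi>(1,3) assms(1) by simp
  then show ?thesis using \<pi>(2) that by simp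
qed

lemma negligible_outer_open:
  fixes S :: "'a::euclidean_space set"
  assumes "negligible S" "0 < e"
  obtains T where "open T" "S \<subseteq> T" "T \<in> lmeasurable" "measure lebesgue T < e"
proof -
  have S: "S \<in> lmeasurable" "measure lebesgue S = 0"
    using assms(1) by (auto simp: negligible_iff_measure)
  obtain T where T: "open T" "S \<subseteq> T" "T - S \<in> lmeasurable" "emeasure lebesgue (T - S) < ennreal e"
    using sets_lebesgue_outer_open[OF fmeasurableD[OF S(1)] assms(2)] by metis
  have eq: "T = S \<union> (T - S)" using T(2) by blast
  have "measure lebesgue (T - S) < e"
    using T(3,4) assms(2) by (simp add: emeasure_eq_measure2 ennreal_less_iff)
  moreover have "measure lebesgue (S \<union> (T - S)) \<le> measure lebesgue S + measure lebesgue (T - S)"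
    using S(1) T(3) by (intro measure_Un_le fmeasurableD)
  ultimately have "measure lebesgue T < e" using eq S(2) by simp
  moreover have "T \<in> lmeasurable" using eq S(1) T(3) by (metis fmeasurable.Un)
  ultimately show ?thesis using T(1,2) that by blast
qed

text \<open>Level sets \<open>n \<le> \<parallel>f\<parallel> < n + 1\<close> are covered separately, so that \<open>f\<close> need not be bounded.\<close>

lemma negligible_gauge:
  fixes f :: "real ^ 'm \<Rightarrow> 'x::real_normed_vector"
  assumes "negligible N" "0 < \<epsilon>"
  obtains \<delta> where "\<And>t. 0 < \<delta> t"
    "\<And>\<pi>. M_partition_in UNIV \<pi> \<Longrightarrow> tagged_in N \<pi> \<Longrightarrow> delta_fine \<delta> \<pi> \<Longrightarrow>
      (\<Sum>(t, I)\<in>\<pi>. measure lebesgue I * norm (f t)) < \<epsilon>"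
proof -
  \<comment> \<open>On level n the norm of f is at most n + 1, so intervals inside an open set of
    measure below \<open>\<eta> n\<close> contribute at most \<epsilon> / 2 * (1 / 2) ^ (n + 1). All
    levels together stay within \<epsilon> / 2, which leaves room for the strict bound.\<close>
  define \<eta> where "\<eta> n = \<epsilon> / 2 * (1 / 2) ^ Suc n / (real n + 1)" for n
  have \<eta>: "\<eta> n > 0" for n using assms by (simp add: \<eta>_def)
  have "\<exists>T. open T \<and> N \<subseteq> T \<and> T \<in> lmeasurable \<and> measure lebesgue T < \<eta> n" for n
    using negligible_outer_open[OF assms(1) \<eta>] by metis
  then obtain T where T: "\<And>n. open (T n)" "\<And>n. N \<subseteq> T n" "\<And>n. T n \<in> lmeasurable"
    "\<And>n. measure lebesgue (T n) < \<eta> n"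
    by metis
  define lev where "lev t = nat \<lfloor>norm (f t)\<rfloor>" for t
  have lev: "norm (f t) \<le> real (lev t) + 1" for t
    unfolding lev_def by linarith
  have "\<exists>r>0. t \<in> N \<longrightarrow> max_ball t r \<subseteq> T (lev t)" for t
    using max_ball_in_open[OF T(1), of t "lev t"] T(2) by (meson subset_iff zero_less_one)
  then obtain \<delta> where \<delta>: "\<And>t. 0 < \<delta> t" "\<And>t. t \<in> N \<Longrightarrow> max_ball t (\<delta> t) \<subseteq> T (lev t)"
    by metis
  show ?thesis
  proof (rule that[OF \<delta>(1)])
    fix \<pi> assume \<pi>: "M_partition_in UNIV \<pi>" "tagged_in N \<pi>" "delta_fine \<delta> \<pi>"
    have fin: "finite \<pi>" using \<pi>(1) by (simp add: M_partition_in_def)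
    define m where "m = Suc (Max (insert 0 ((lev \<circ> fst) ` \<pi>)))"
    have m: "lev (fst x) < m" if "x \<in> \<pi>" for x
      unfolding m_def less_Suc_eq_le using fin that by (intro Max_ge) auto
    have "(\<Sum>(t, I)\<in>\<pi>. measure lebesgue I * norm (f t)) =
        (\<Sum>n<m. \<Sum>x\<in>{x \<in> \<pi>. lev (fst x) = n}. measure lebesgue (snd x) * norm (f (fst x)))"
      using fin m by (subst sum.group) (auto simp: case_prod_unfold)
    also have "\<dots> \<le> (\<Sum>n<m. \<epsilon> / 2 * (1 / 2) ^ Suc n)"
    proof (rule sum_mono)
      fix n
      let ?P = "{x \<in> \<pi>. lev (fst x) = n}"
      have "snd x \<subseteq> T n" if "x \<in> ?P" for x
      proof -
        have "fst x \<in> N" "snd x \<subseteq> max_ball (fst x) (\<delta> (fst x))"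
          using \<pi>(2) delta_fineD[OF \<pi>(3)] that by (auto simp: tagged_in_def)
        then show ?thesis using \<delta>(2) that by blast
      qed
      then have le: "(\<Sum>x\<in>?P. measure lebesgue (snd x)) \<le> measure lebesgue (T n)"
        using box_family_subset[OF M_partition_in_box_family[OF \<pi>(1)]] T(3)
        by (intro box_family_measure_le) auto
      have "(\<Sum>x\<in>?P. measure lebesgue (snd x) * norm (f (fst x))) \<le>
          (\<Sum>x\<in>?P. measure lebesgue (snd x) * (real n + 1))"
        using lev by (intro sum_mono mult_left_mono) auto
      also have "\<dots> \<le> \<eta> n * (real n + 1)"
        unfolding sum_distrib_right[symmetric]
        using le T(4)[of n] by (intro mult_right_mono) auto
      also have "\<dots> = \<epsilon> / 2 * (1 / 2) ^ Suc n"
      proof -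
        have "real n + 1 \<noteq> 0" by linarith
        then show ?thesis
          unfolding \<eta>_def by (metis nonzero_eq_divide_eq)
      qed
      finally show "(\<Sum>x\<in>?P. measure lebesgue (snd x) * norm (f (fst x))) \<le>
          \<epsilon> / 2 * (1 / 2) ^ Suc n" .
    qed
    also have "\<dots> = \<epsilon> / 2 * (\<Sum>n<m. (1 / 2) ^ Suc n)"
      by (rule sum_distrib_left[symmetric])
    also have "(\<Sum>n<m. (1 / 2 :: real) ^ Suc n) = 1 - (1 / 2) ^ m"
      by (induction m) (auto simp: field_simps)
    also have "\<epsilon> / 2 * (1 - (1 / 2) ^ m) \<le> \<epsilon> / 2 * 1"
      using assms(2) by (intro mult_left_mono) auto
    also have "\<dots> < \<epsilon>" using assms(2) by simp
    finally show "(\<Sum>(t, I)\<in>\<pi>. measure lebesgue I * norm (f t)) < \<epsilon>" .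
  qed
qed

text \<open>Cutting the intervals and cutting the function give nearly the same Riemann sum. Near a
  tag off the boundary of the box, a small gauge keeps the interval entirely inside or entirely
  outside, and the two terms agree. Only boundary tags can differ, and these form a null
  set.\<close>

lemma restrict_to_box_gauge:
  fixes f :: "real ^ 'm \<Rightarrow> 'x::real_normed_vector"
  assumes "0 < \<epsilon>"
  obtains \<delta> where "\<And>t. 0 < \<delta> t"
    "\<And>\<pi>. M_partition_in UNIV \<pi> \<Longrightarrow> delta_fine \<delta> \<pi> \<Longrightarrow>
      norm ((\<Sum>(t, I)\<in>\<pi>. measure lebesgue (cbox c d \<inter> I) *\<^sub>R f t) -
        (\<Sum>(t, I)\<in>\<pi>. measure lebesgue I *\<^sub>R (indicator (cbox c d) t *\<^sub>R f t))) < \<epsilon>"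
proof -
  let ?N = "cbox c d - box c d"
  obtain \<delta>0 where \<delta>0: "\<And>t. 0 < \<delta>0 t"
    "\<And>\<pi>. M_partition_in UNIV \<pi> \<Longrightarrow> tagged_in ?N \<pi> \<Longrightarrow> delta_fine \<delta>0 \<pi> \<Longrightarrow>
      (\<Sum>(t, I)\<in>\<pi>. measure lebesgue I * norm (f t)) < \<epsilon>"
    using negligible_gauge[OF negligible_frontier_interval assms] by metis
  have "\<exists>r>0. (t \<in> box c d \<longrightarrow> max_ball t r \<subseteq> box c d) \<and>
      (t \<notin> cbox c d \<longrightarrow> max_ball t r \<subseteq> - cbox c d)" for t
  proof -
    consider "t \<in> box c d" | "t \<in> - cbox c d" | "t \<in> ?N" by blast
    then show ?thesis
    proof cases
      case 1
      then have "t \<in> cbox c d" using box_subset_cbox by blast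
      with 1 show ?thesis using max_ball_in_open[OF open_box 1] by auto
    next
      case 2
      then have "t \<notin> box c d" using box_subset_cbox by blast
      with 2 show ?thesis using max_ball_in_open[OF _ 2] by (auto simp: open_Compl)
    next
      case 3
      \<comment> \<open>At boundary tags the radius is arbitrary; \<open>\<delta>0\<close> controls
        them.\<close>
      then show ?thesis by (auto intro: exI[of _ 1])
    qed
  qed
  then obtain r where r: "\<And>t. 0 < r t" "\<And>t. t \<in> box c d \<Longrightarrow> max_ball t (r t) \<subseteq> box c d"
    "\<And>t. t \<notin> cbox c d \<Longrightarrow> max_ball t (r t) \<subseteq> - cbox c d"
    by metis
  show ?thesis
  proof (rule that)
    show "0 < min (\<delta>0 t) (r t)" for t using \<delta>0 r by simp
    fix \<pi> assume \<pi>: "M_partition_in UNIV \<pi>" "delta_fine (\<lambda>t. min (\<delta>0 t) (r t)) \<pi>"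
    define \<rho> where "\<rho> = {x \<in> \<pi>. fst x \<in> ?N}"
    have fin: "finite \<pi>" using \<pi>(1) by (simp add: M_partition_in_def)
    have box: "\<exists>a b. snd x = cbox a b" if "x \<in> \<pi>" for x
      using box_familyD(2)[OF M_partition_in_box_family[OF \<pi>(1)] that] .
    let ?g = "\<lambda>x. measure lebesgue (cbox c d \<inter> snd x) *\<^sub>R f (fst x) -
      measure lebesgue (snd x) *\<^sub>R (indicator (cbox c d) (fst x) *\<^sub>R f (fst x))"
    have zero: "?g x = 0" if x: "x \<in> \<pi> - \<rho>" for x
    proof -
      have sub: "snd x \<subseteq> max_ball (fst x) (r (fst x))"
        using delta_fineD[OF \<pi>(2), of x] that
          max_ball_mono[of "min (\<delta>0 (fst x)) (r (fst x))" "r (fst x)" "fst x"]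
        by auto
      consider "fst x \<in> box c d" | "fst x \<notin> cbox c d" using x unfolding \<rho>_def by blast
      then show ?thesis
      proof cases
        case 1
        then have "cbox c d \<inter> snd x = snd x" using sub r(2) box_subset_cbox by blast
        then show ?thesis using 1 box_subset_cbox[of c d] by auto
      next
        case 2
        then have "cbox c d \<inter> snd x = {}" using sub r(3) by blast
        then show ?thesis using 2 by simp
      qed
    qed
    have le: "norm (?g x) \<le> measure lebesgue (snd x) * norm (f (fst x))" if "x \<in> \<rho>" for x
    proof -
      have "x \<in> \<pi>" using that by (simp add: \<rho>_def)
      then obtain a b where ab: "snd x = cbox a b" using box by blast
      have "measure lebesgue (cbox c d \<inter> snd x) \<le> measure lebesgue (snd x)"
        unfolding ab by (intro measure_mono_fmeasurable) auto
      then have "\<bar>measure lebesgue (cbox c d \<inter> snd x) - measure lebesgue (snd x)\<bar>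
          \<le> measure lebesgue (snd x)"
        by simp
      moreover have "?g x =
          (measure lebesgue (cbox c d \<inter> snd x) - measure lebesgue (snd x)) *\<^sub>R f (fst x)"
        using that by (simp add: \<rho>_def scaleR_diff_left)
      ultimately show ?thesis by (simp add: mult_right_mono)
    qed
    have "(\<Sum>(t, I)\<in>\<pi>. measure lebesgue (cbox c d \<inter> I) *\<^sub>R f t) -
        (\<Sum>(t, I)\<in>\<pi>. measure lebesgue I *\<^sub>R (indicator (cbox c d) t *\<^sub>R f t)) = sum ?g \<pi>"
      by (simp add: case_prod_unfold sum_subtractf)
    also have "sum ?g \<pi> = sum ?g \<rho>"
      using zero fin by (intro sum.mono_neutral_right) (auto simp: \<rho>_def)
    also have "norm \<dots> \<le> (\<Sum>x\<in>\<rho>. measure lebesgue (snd x) * norm (f (fst x)))"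
      using le by (rule sum_norm_le)
    also have "\<dots> < \<epsilon>"
    proof -
      have "\<rho> \<subseteq> \<pi>" by (auto simp: \<rho>_def)
      moreover have "delta_fine \<delta>0 \<pi>" using \<pi>(2) by (rule delta_fine_mono) simp
      moreover have "tagged_in ?N \<rho>" by (auto simp: tagged_in_def \<rho>_def)
      ultimately show ?thesis
        using \<delta>0(2)[OF M_partition_in_subset[OF \<pi>(1)] _ delta_fine_subset, of \<rho> \<pi>]
        by (simp add: case_prod_unfold)
    qed
    finally show "norm ((\<Sum>(t, I)\<in>\<pi>. measure lebesgue (cbox c d \<inter> I) *\<^sub>R f t) -
        (\<Sum>(t, I)\<in>\<pi>. measure lebesgue I *\<^sub>R (indicator (cbox c d) t *\<^sub>R f t))) < \<epsilon>" .
  qed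
qed

section \<open>The Saks--Henstock estimate\<close>

text \<open>Intersecting with \<open>W\<close> gives a value also to boxes that leave
  \<open>W\<close>, as the intervals tagged on the boundary in condition (3) may do. The value 0 on
  degenerate boxes replaces the arbitrary value of the total function \<open>F\<close>
  there.\<close>

definition zero_ext ::
    "(real ^ 'm) set \<Rightarrow> ((real ^ 'm) set \<Rightarrow> 'x::zero) \<Rightarrow> (real ^ 'm) set \<Rightarrow> 'x" where
  "zero_ext W F J = (if interior (J \<inter> W) = {} then 0 else F (J \<inter> W))"

lemma zero_ext_interval: "I \<in> intervals_in W \<Longrightarrow> zero_ext W F I = F I"
  unfolding zero_ext_def intervals_in_def intervals_iff by (auto simp: Int_absorb2)

lemma zero_ext_degenerate: "interior J = {} \<Longrightarrow> zero_ext W F J = 0"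
  unfolding zero_ext_def by simp

text \<open>The open set \<open>interior (cbox u v) \<inter> S\<close> lies in a set with empty
  interior, so it is empty; and a non-degenerate box is the closure of its interior. With
  \<open>S\<close> an open half-space, a box whose part on one side of a hyperplane is flat lies
  wholly on the other side.\<close>

lemma box_one_sided:
  fixes u v :: "real ^ 'm"
  assumes "interior (cbox u v) \<noteq> {}" "open S" "interior (cbox u v \<inter> closure S) = {}"
  shows "cbox u v \<subseteq> - S"
proof -
  have "interior (cbox u v) \<inter> S \<subseteq> interior (cbox u v \<inter> closure S)"
    using assms(2) by (intro interior_maximal Int_mono interior_subset closure_subset open_Int) auto
  then have "interior (cbox u v) \<subseteq> - S" using assms(3) by blast
  moreover have "closed (- S)" using assms(2) by (simp add: closed_Compl)
  ultimately have "closure (interior (cbox u v)) \<subseteq> - S" by (rule closure_minimal)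
  then show ?thesis
    using convex_closure_interior[of "cbox u v"] assms(1) by simp
qed

text \<open>Additivity of \<open>F\<close> applies directly only when both halves of a split are
  non-degenerate. If one half is flat, the other is the whole box by \<open>box_one_sided\<close>,
  and the flat half contributes 0.\<close>

lemma operative_zero_ext:
  fixes F :: "(real ^ 'm) set \<Rightarrow> 'x::real_normed_vector"
  assumes F: "additive_interval_function (cbox a b) F"
  shows "operative (+) 0 (zero_ext (cbox a b) F)"
proof
  let ?G = "zero_ext (cbox a b) F"
  show "?G (cbox c d) = 0" if "box c d = {}" for c d
    using that by (simp add: zero_ext_degenerate)
  fix c d :: "real ^ 'm" and r k assume k: "k \<in> (Basis :: (real ^ 'm) set)"
  let ?L = "{x. x \<bullet> k \<le> r}" and ?U = "{x. x \<bullet> k \<ge> r}"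
  define A where "A = cbox c d \<inter> cbox a b"
  obtain u v where A: "A = cbox u v" unfolding A_def Int_interval by blast
  have box: "\<exists>p q. A \<inter> ?L = cbox p q" "\<exists>p q. A \<inter> ?U = cbox p q"
    unfolding A interval_split[OF k] by blast+
  have un: "(A \<inter> ?L) \<union> (A \<inter> ?U) = A" by auto
  have G: "?G (cbox c d) = (if interior A = {} then 0 else F A)"
    "?G (cbox c d \<inter> ?L) = (if interior (A \<inter> ?L) = {} then 0 else F (A \<inter> ?L))"
    "?G (cbox c d \<inter> ?U) = (if interior (A \<inter> ?U) = {} then 0 else F (A \<inter> ?U))"
    unfolding zero_ext_def A_def by (simp_all add: Int_ac)
  have half: "closure {x. x \<bullet> k < r} = ?L" "closure {x. x \<bullet> k > r} = ?U"
    using k closure_halfspace_lt[of k r] closure_halfspace_gt[of k r]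
    by (auto simp: inner_commute nonzero_Basis)
  consider "interior A = {}" | "interior A \<noteq> {}" "interior (A \<inter> ?L) = {}"
    | "interior A \<noteq> {}" "interior (A \<inter> ?U) = {}"
    | "interior (A \<inter> ?L) \<noteq> {}" "interior (A \<inter> ?U) \<noteq> {}" "interior A \<noteq> {}" by blast
  then show "?G (cbox c d) = ?G (cbox c d \<inter> ?L) + ?G (cbox c d \<inter> ?U)"
  proof cases
    case 1
    then have "interior (A \<inter> ?L) = {}" "interior (A \<inter> ?U) = {}" by auto
    with 1 show ?thesis unfolding G by simp
  next
    case 2
    then have "A \<subseteq> - {x. x \<bullet> k < r}"
      unfolding A half(1)[symmetric] by (intro box_one_sided) (auto simp: open_halfspace_component_lt)
    then have "A \<inter> ?U = A" by auto
    with 2 show ?thesis unfolding G by simp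
  next
    case 3
    then have "A \<subseteq> - {x. x \<bullet> k > r}"
      unfolding A half(2)[symmetric] by (intro box_one_sided) (auto simp: open_halfspace_component_gt)
    then have "A \<inter> ?L = A" by auto
    with 3 show ?thesis unfolding G by simp
  next
    case 4
    have "A \<subseteq> cbox a b" unfolding A_def by simp
    then have "A \<inter> ?L \<in> intervals_in (cbox a b)" "A \<inter> ?U \<in> intervals_in (cbox a b)"
      "A \<in> intervals_in (cbox a b)"
      using intervals_inI[OF box(1) 4(1), of "cbox a b"] intervals_inI[OF box(2) 4(2), of "cbox a b"]
        intervals_inI[OF _ 4(3), of "cbox a b"] A by blast+
    moreover have "nonoverlapping (A \<inter> ?L) (A \<inter> ?U)"
    proof -
      have "interior ?L = {x. x \<bullet> k < r}" "interior ?U = {x. x \<bullet> k > r}"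
        using k interior_halfspace_le[of k r] interior_halfspace_ge[of k r]
        by (auto simp: inner_commute nonzero_Basis)
      then show ?thesis unfolding nonoverlapping_def by auto
    qed
    ultimately have "F A = F (A \<inter> ?L) + F (A \<inter> ?U)"
      using F unfolding additive_interval_function_def by (metis un)
    with 4 show ?thesis unfolding G by simp
  qed
qed

section \<open>Equivalence of the estimate with being the primitive\<close>

text \<open>The set \<open>W\<close> need not be an interval: with \<open>interior I0\<close> in its
  place this is condition (1), with \<open>I0\<close> it is the full estimate.\<close>

definition henstock_primitive ::
    "(real ^ 'm \<Rightarrow> 'x::real_normed_vector) \<Rightarrow> (real ^ 'm) set \<Rightarrow> ((real ^ 'm) set \<Rightarrow> 'x) \<Rightarrow> bool"
  where
  "henstock_primitive f W F \<longleftrightarrow>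
     (\<forall>\<epsilon>>0. \<exists>\<delta>. gauge_on W \<delta> \<and>
        (\<forall>\<pi>. M_partition_in W \<pi> \<and> delta_fine \<delta> \<pi> \<longrightarrow>
           norm (\<Sum>(t, I)\<in>\<pi>. measure lebesgue I *\<^sub>R f t - F I) < \<epsilon>))"

text \<open>The estimate at a fixed gauge survives degenerate pieces, since both the measure and
  \<open>zero_ext\<close> vanish on them. In this form it applies directly to intervals that have
  been cut.\<close>

lemma henstock_box_family:
  fixes f :: "real ^ 'm \<Rightarrow> 'x::real_normed_vector" and K :: "'i \<Rightarrow> (real ^ 'm) set"
  assumes hen: "\<And>\<pi>. M_partition_in W \<pi> \<Longrightarrow> delta_fine \<delta> \<pi> \<Longrightarrow>
      norm (\<Sum>(t, I)\<in>\<pi>. measure lebesgue I *\<^sub>R f t - F I) < \<epsilon>"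
    and K: "box_family A K"
    and sub: "\<And>i. i \<in> A \<Longrightarrow> t i \<in> W \<and> K i \<subseteq> W \<and> K i \<subseteq> max_ball (t i) (\<delta> (t i))"
  shows "norm (\<Sum>i\<in>A. measure lebesgue (K i) *\<^sub>R f (t i) - zero_ext W F (K i)) < \<epsilon>"
proof -
  let ?h = "\<lambda>s I. measure lebesgue I *\<^sub>R f s - zero_ext W F I"
  have zero: "?h (t i) (K i) = 0" if i: "i \<in> A" "interior (K i) = {}" for i
  proof -
    have "measure lebesgue (K i) = 0"
      using box_familyD(2)[OF K i(1)] i(2) measure_box_eq_0 by metis
    then show ?thesis using i(2) by (simp add: zero_ext_degenerate)
  qed
  obtain \<pi> where \<pi>: "M_partition_in W \<pi>" "delta_fine \<delta> \<pi>"
    "(\<Sum>(s, I)\<in>\<pi>. ?h s I) = (\<Sum>i\<in>A. ?h (t i) (K i))"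
    by (rule box_family_partition[where t = t and h = ?h and \<delta> = \<delta>, OF K])
      (erule sub, erule (1) zero, rule that)
  have "(\<Sum>(s, I)\<in>\<pi>. ?h s I) = (\<Sum>(s, I)\<in>\<pi>. measure lebesgue I *\<^sub>R f s - F I)"
    using \<pi>(1) zero_ext_interval[of _ W F]
    by (intro sum.cong refl) (auto simp: M_partition_in_def)
  then show ?thesis using hen[OF \<pi>(1,2)] \<pi>(3) by simp
qed

text \<open>Cutting every interval of a fine partition of the whole box by \<open>J\<close>, with
  the tags kept, leaves a fine family whose \<open>zero_ext\<close> values add up to
  \<open>F J\<close>. The estimate compares these with the cut Riemann sum, and
  \<open>restrict_to_box_gauge\<close> replaces the cut intervals by the indicator of
  \<open>J\<close>.\<close>

lemma henstock_imp_primitive: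
  fixes f :: "real ^ 'm \<Rightarrow> 'x::real_normed_vector"
  assumes W: "cbox a b \<in> intervals" and F: "additive_interval_function (cbox a b) F"
    and hen: "henstock_primitive f (cbox a b) F"
  shows "mcshane_integrable_with_primitive f (cbox a b) F"
proof -
  let ?W = "cbox a b"
  have int: "has_mcshane_integral (\<lambda>t. indicator J t *\<^sub>R f t) (F J) ?W" if J: "J \<in> intervals_in ?W" for J
    unfolding has_mcshane_integral_def
  proof (intro allI impI)
    fix \<epsilon> :: real assume "0 < \<epsilon>"
    obtain c d where cd: "J = cbox c d" using J unfolding intervals_in_def intervals_iff by blast
    obtain \<delta>1 where \<delta>1: "gauge_on ?W \<delta>1" "\<And>\<pi>. M_partition_in ?W \<pi> \<Longrightarrow> delta_fine \<delta>1 \<pi> \<Longrightarrow>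
        norm (\<Sum>(t, I)\<in>\<pi>. measure lebesgue I *\<^sub>R f t - F I) < \<epsilon> / 2"
      using hen \<open>0 < \<epsilon>\<close> unfolding henstock_primitive_def by (meson half_gt_zero)
    obtain \<delta>2 where \<delta>2: "\<And>t. 0 < \<delta>2 t"
      "\<And>\<pi>. M_partition_in UNIV \<pi> \<Longrightarrow> delta_fine \<delta>2 \<pi> \<Longrightarrow>
        norm ((\<Sum>(t, I)\<in>\<pi>. measure lebesgue (cbox c d \<inter> I) *\<^sub>R f t) -
          (\<Sum>(t, I)\<in>\<pi>. measure lebesgue I *\<^sub>R (indicator (cbox c d) t *\<^sub>R f t))) < \<epsilon> / 2"
      by (rule restrict_to_box_gauge[OF half_gt_zero[OF \<open>0 < \<epsilon>\<close>], of c d f]) (rule that)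
    let ?\<delta> = "\<lambda>t. min (\<delta>1 t) (\<delta>2 t)"
    show "\<exists>\<delta>. gauge_on ?W \<delta> \<and> (\<forall>\<pi>. M_partition_of ?W \<pi> \<and> delta_fine \<delta> \<pi> \<longrightarrow>
        norm ((\<Sum>(t, I)\<in>\<pi>. measure lebesgue I *\<^sub>R (indicator J t *\<^sub>R f t)) - F J) < \<epsilon>)"
    proof (intro exI[of _ ?\<delta>] conjI allI impI)
      show "gauge_on ?W ?\<delta>" using \<delta>1(1) \<delta>2(1) by (simp add: gauge_on_def)
      fix \<pi> assume \<pi>: "M_partition_of ?W \<pi> \<and> delta_fine ?\<delta> \<pi>"
      then have \<pi>W: "M_partition_in ?W \<pi>" and cover: "(\<Union>x\<in>\<pi>. snd x) = ?W"
        by (auto simp: M_partition_of_def case_prod_unfold)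
      have fine: "delta_fine \<delta>1 \<pi>" "delta_fine \<delta>2 \<pi>"
        using \<pi> by (auto intro: delta_fine_mono)
      have fam: "box_family \<pi> snd" using \<pi>W by (rule M_partition_in_box_family)
      have "norm (\<Sum>x\<in>\<pi>. measure lebesgue (J \<inter> snd x) *\<^sub>R f (fst x) - zero_ext ?W F (J \<inter> snd x))
          < \<epsilon> / 2"
      proof (rule henstock_box_family[OF \<delta>1(2)])
        show "box_family \<pi> (\<lambda>x. J \<inter> snd x)" unfolding cd using fam by (rule box_family_Int_box)
        show "fst x \<in> ?W \<and> J \<inter> snd x \<subseteq> ?W \<and> J \<inter> snd x \<subseteq> max_ball (fst x) (\<delta>1 (fst x))"
          if "x \<in> \<pi>" for x
          using that \<pi>W J delta_fineD[OF fine(1) that]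
          by (auto simp: M_partition_in_def intervals_in_def)
      qed
      moreover have "(\<Sum>x\<in>\<pi>. zero_ext ?W F (J \<inter> snd x)) = F J"
        using operative_box_family[OF operative_zero_ext[OF F] fam, of c d] J zero_ext_interval[OF J]
        by (simp add: cover cd intervals_in_def)
      ultimately have 1: "norm ((\<Sum>(t, I)\<in>\<pi>. measure lebesgue (J \<inter> I) *\<^sub>R f t) - F J) < \<epsilon> / 2"
        by (simp add: sum_subtractf case_prod_unfold)
      have "norm ((\<Sum>(t, I)\<in>\<pi>. measure lebesgue I *\<^sub>R (indicator J t *\<^sub>R f t)) -
          (\<Sum>(t, I)\<in>\<pi>. measure lebesgue (J \<inter> I) *\<^sub>R f t)) < \<epsilon> / 2"
        using \<delta>2(2)[OF M_partition_in_mono[OF \<pi>W] fine(2)] by (simp add: cd norm_minus_commute)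
      from norm_diff_triangle_less[OF this 1]
      show "norm ((\<Sum>(t, I)\<in>\<pi>. measure lebesgue I *\<^sub>R (indicator J t *\<^sub>R f t)) - F J) < \<epsilon>"
        by simp
    qed
  qed
  \<comment> \<open>This is the case where \<open>J\<close> is the whole box: the indicator is 1 at
    every tag.\<close>
  have "has_mcshane_integral f (F ?W) ?W"
  proof -
    have "(\<Sum>(t, I)\<in>\<pi>. measure lebesgue I *\<^sub>R (indicator ?W t *\<^sub>R f t)) =
        (\<Sum>(t, I)\<in>\<pi>. measure lebesgue I *\<^sub>R f t)" if "M_partition_of ?W \<pi>" for \<pi>
      using that by (intro sum.cong) (auto simp: M_partition_of_def M_partition_in_def)
    then show ?thesis
      using int[of ?W] W unfolding has_mcshane_integral_def intervals_in_def by auto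
  qed
  then show ?thesis
    using int unfolding mcshane_integrable_with_primitive_def mcshane_integrable_def by blast
qed

text \<open>The gauge at which the integral over the small box is approximated depends on that box.
  Since a single partition is asked for, \<delta> may be shrunk accordingly, and the result is still
  fine for the original \<delta>. This allows a different partition for each of the boxes that
  complete a partial partition.\<close>

lemma fine_restricted_sum:
  fixes f :: "real ^ 'm \<Rightarrow> 'x::real_normed_vector"
  assumes W: "box a b \<noteq> {}" and \<delta>: "gauge_on (cbox a b) \<delta>" and "0 < \<epsilon>"
    and sub: "cbox c d \<subseteq> cbox a b"
    and int: "\<And>J. J \<in> intervals_in (cbox a b) \<Longrightarrow>
      has_mcshane_integral (\<lambda>t. indicator J t *\<^sub>R f t) (F J) (cbox a b)"
  obtains \<pi> where "M_partition_of (cbox a b) \<pi>" "delta_fine \<delta> \<pi>"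
    "norm ((\<Sum>(t, I)\<in>\<pi>. measure lebesgue (cbox c d \<inter> I) *\<^sub>R f t) -
      zero_ext (cbox a b) F (cbox c d)) < \<epsilon>"
proof (cases "interior (cbox c d) = {}")
  case True
  obtain \<pi> where \<pi>: "M_partition_of (cbox a b) \<pi>" "delta_fine \<delta> \<pi>"
    using fine_M_partition_exists[OF W \<delta>] .
  have zero: "measure lebesgue (cbox c d \<inter> snd x) = 0" if x: "x \<in> \<pi>" for x
  proof -
    have "box_family \<pi> snd"
      using \<pi>(1) M_partition_in_box_family by (auto simp: M_partition_of_def)
    then obtain u v where "cbox c d \<inter> snd x = cbox u v"
      using box_familyD(2)[OF box_family_Int_box x] by metis
    moreover have "interior (cbox c d \<inter> snd x) = {}" using True by simp
    ultimately show ?thesis by (metis measure_box_eq_0)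
  qed
  then have "(\<Sum>(t, I)\<in>\<pi>. measure lebesgue (cbox c d \<inter> I) *\<^sub>R f t) = 0"
    by (intro sum.neutral) auto
  then show ?thesis using that[OF \<pi>] \<open>0 < \<epsilon>\<close> True by (simp add: zero_ext_degenerate)
next
  case False
  let ?J = "cbox c d"
  have J: "?J \<in> intervals_in (cbox a b)" using False sub by (intro intervals_inI) auto
  obtain \<delta>1 where \<delta>1: "gauge_on (cbox a b) \<delta>1"
    "\<And>\<pi>. M_partition_of (cbox a b) \<pi> \<and> delta_fine \<delta>1 \<pi> \<Longrightarrow>
      norm ((\<Sum>(t, I)\<in>\<pi>. measure lebesgue I *\<^sub>R (indicator ?J t *\<^sub>R f t)) - F ?J) < \<epsilon> / 2"
    using int[OF J] half_gt_zero[OF \<open>0 < \<epsilon>\<close>] unfolding has_mcshane_integral_def by meson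
  obtain \<delta>2 where \<delta>2: "\<And>t. 0 < \<delta>2 t"
    "\<And>\<pi>. M_partition_in UNIV \<pi> \<Longrightarrow> delta_fine \<delta>2 \<pi> \<Longrightarrow>
      norm ((\<Sum>(t, I)\<in>\<pi>. measure lebesgue (?J \<inter> I) *\<^sub>R f t) -
        (\<Sum>(t, I)\<in>\<pi>. measure lebesgue I *\<^sub>R (indicator ?J t *\<^sub>R f t))) < \<epsilon> / 2"
    by (rule restrict_to_box_gauge[OF half_gt_zero[OF \<open>0 < \<epsilon>\<close>], of c d f]) (rule that)
  let ?\<delta> = "\<lambda>t. min (\<delta> t) (min (\<delta>1 t) (\<delta>2 t))"
  have "gauge_on (cbox a b) ?\<delta>" using \<delta> \<delta>1(1) \<delta>2(1) by (simp add: gauge_on_def)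
  then obtain \<pi> where \<pi>: "M_partition_of (cbox a b) \<pi>" "delta_fine ?\<delta> \<pi>"
    using fine_M_partition_exists[OF W] by blast
  have fine: "delta_fine \<delta> \<pi>" "delta_fine \<delta>1 \<pi>" "delta_fine \<delta>2 \<pi>"
    using \<pi>(2) by (auto intro: delta_fine_mono)
  have "M_partition_in UNIV \<pi>"
    using \<pi>(1) M_partition_in_mono by (auto simp: M_partition_of_def)
  from norm_diff_triangle_less[OF \<delta>2(2)[OF this fine(3)] \<delta>1(2)]
  have "norm ((\<Sum>(t, I)\<in>\<pi>. measure lebesgue (?J \<inter> I) *\<^sub>R f t) - F ?J) < \<epsilon>"
    using \<pi>(1) fine(2) by simp
  then show ?thesis using that[OF \<pi>(1) fine(1)] by (simp add: zero_ext_interval[OF J])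
qed

text \<open>A partial partition \<open>\<pi>\<close> is completed to one of \<open>W\<close>; on the boxes added, the Riemann sums
  are as close to \<open>F\<close> as we like, so the whole discrepancy is due to \<open>\<pi>\<close>.\<close>

lemma primitive_imp_henstock:
  fixes f :: "real ^ 'm \<Rightarrow> 'x::real_normed_vector"
  assumes W: "cbox a b \<in> intervals" and F: "additive_interval_function (cbox a b) F"
    and prim: "mcshane_integrable_with_primitive f (cbox a b) F"
  shows "henstock_primitive f (cbox a b) F"
  unfolding henstock_primitive_def
proof (intro allI impI)
  fix \<epsilon> :: real assume "0 < \<epsilon>"
  let ?W = "cbox a b"
  let ?G = "zero_ext ?W F"
  have box: "box a b \<noteq> {}" using W by (simp add: intervals_iff)
  have int: "has_mcshane_integral (\<lambda>t. indicator J t *\<^sub>R f t) (F J) ?W" if "J \<in> intervals_in ?W" for J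
    using prim that unfolding mcshane_integrable_with_primitive_def by blast
  have WW: "?W \<in> intervals_in ?W" using W by (simp add: intervals_in_def)
  obtain \<delta> where \<delta>: "gauge_on ?W \<delta>"
    "\<And>\<pi>. M_partition_of ?W \<pi> \<and> delta_fine \<delta> \<pi> \<Longrightarrow>
      norm ((\<Sum>(t, I)\<in>\<pi>. measure lebesgue I *\<^sub>R (indicator ?W t *\<^sub>R f t)) - F ?W) < \<epsilon> / 2"
    using int[OF WW] half_gt_zero[OF \<open>0 < \<epsilon>\<close>] unfolding has_mcshane_integral_def by meson
  show "\<exists>\<delta>. gauge_on ?W \<delta> \<and> (\<forall>\<pi>. M_partition_in ?W \<pi> \<and> delta_fine \<delta> \<pi> \<longrightarrow>
      norm (\<Sum>(t, I)\<in>\<pi>. measure lebesgue I *\<^sub>R f t - F I) < \<epsilon>)"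
  proof (intro exI[of _ \<delta>] conjI allI impI)
    show "gauge_on ?W \<delta>" by (fact \<delta>(1))
    fix \<pi> assume "M_partition_in ?W \<pi> \<and> delta_fine \<delta> \<pi>"
    then have \<pi>: "M_partition_in ?W \<pi>" and fine: "delta_fine \<delta> \<pi>" by auto
    have fam: "box_family \<pi> snd" using \<pi> by (rule M_partition_in_box_family)
    have \<pi>W: "fst x \<in> ?W" "snd x \<in> intervals_in ?W" if "x \<in> \<pi>" for x
      using \<pi> that by (auto simp: M_partition_in_def)
    have ne: "interior (snd x) \<noteq> {}" if "x \<in> \<pi>" for x
      using intervals_inD(2)[OF \<pi>W(2)[OF that]] .
    have inj: "x = y" if "x \<in> \<pi>" "y \<in> \<pi>" "snd x = snd y" for x y
      using box_familyD(3)[OF fam that(1,2)] ne[OF that(1)] that(3) by auto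
    define p where "p = snd ` \<pi>"
    have "{} \<notin> p" unfolding p_def using ne by force
    then have "p - {{}} = p" by simp
    then have "p division_of \<Union>p"
      using box_family_division[OF fam] by (simp add: p_def)
    moreover have "\<Union>p \<subseteq> ?W" unfolding p_def using intervals_inD(3)[OF \<pi>W(2)] by blast
    ultimately obtain q where q: "p \<subseteq> q" "q division_of ?W"
      by (rule partial_division_extend_interval)
    note qD = division_ofD[OF q(2)]
    \<comment> \<open>The allowance \<epsilon> / 2 is shared among the boxes of \<open>q\<close>;
      adding 1 keeps the divisor positive whatever the size of \<open>q\<close>.\<close>
    define \<eta> where "\<eta> = \<epsilon> / 2 / (real (card q) + 1)"
    have "0 < \<eta>" using \<open>0 < \<epsilon>\<close> by (simp add: \<eta>_def)
    have "\<exists>P. M_partition_of ?W P \<and> delta_fine \<delta> P \<and>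
        norm ((\<Sum>(t, I)\<in>P. measure lebesgue (L \<inter> I) *\<^sub>R f t) - ?G L) < \<eta>" if L: "L \<in> q" for L
    proof -
      obtain c d where cd: "L = cbox c d" using qD(4)[OF L] by blast
      have "cbox c d \<subseteq> ?W" using qD(2)[OF L] cd by simp
      from fine_restricted_sum[OF box \<delta>(1) \<open>0 < \<eta>\<close> this int] show ?thesis
        unfolding cd by metis
    qed
    then obtain P where P: "\<And>L. L \<in> q \<Longrightarrow> M_partition_of ?W (P L)"
      "\<And>L. L \<in> q \<Longrightarrow> delta_fine \<delta> (P L)"
      "\<And>L. L \<in> q \<Longrightarrow>
        norm ((\<Sum>(t, I)\<in>P L. measure lebesgue (L \<inter> I) *\<^sub>R f t) - ?G L) < \<eta>"
      by metis
    \<comment> \<open>A box of \<pi> keeps its own tag, through the one pair of \<pi> that it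
      belongs to. An added box receives the partition \<open>P L\<close> of all of
      \<open>?W\<close>, whose intervals are cut by \<open>L\<close> in \<open>?K\<close>.\<close>
    define Q where "Q L = (if L \<in> p then {x \<in> \<pi>. snd x = L} else P L)" for L
    define A where "A = Sigma q Q"
    let ?K = "\<lambda>(L, x). L \<inter> snd x" and ?t = "\<lambda>(L, x). fst x"
    have Qin: "M_partition_in ?W (Q L)" "delta_fine \<delta> (Q L)" if "L \<in> q" for L
      using M_partition_in_subset[OF \<pi>] delta_fine_subset[OF fine] P(1,2)[OF that]
      by (auto simp: Q_def M_partition_of_def)
    have Qcover: "L \<subseteq> (\<Union>x\<in>Q L. snd x)" if "L \<in> q" for L
    proof (cases "L \<in> p")
      case True
      then obtain x where x: "x \<in> \<pi>" "snd x = L" unfolding p_def by blast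
      then have "x \<in> Q L" using True by (simp add: Q_def)
      then show ?thesis using x(2) by blast
    next
      case False
      have "(\<Union>x\<in>P L. snd x) = ?W"
        using P(1)[OF that] by (auto simp: M_partition_of_def case_prod_unfold)
      then show ?thesis using False qD(2)[OF that] by (simp add: Q_def)
    qed
    have Qfin: "finite (Q L)" if "L \<in> q" for L
      using Qin(1)[OF that] by (simp add: M_partition_in_def)
    have Afam: "box_family A ?K"
      unfolding A_def using M_partition_in_box_family[OF Qin(1)]
      by (intro box_family_Sigma) (auto simp: box_family_def pairwise_def qD(1,4,5))
    have Asub: "?t i \<in> ?W \<and> ?K i \<subseteq> ?W \<and> ?K i \<subseteq> max_ball (?t i) (\<delta> (?t i))" if "i \<in> A" for i
    proof -
      obtain L x where i: "i = (L, x)" "L \<in> q" "x \<in> Q L" using \<open>i \<in> A\<close> by (auto simp: A_def)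
      have "fst x \<in> ?W" using Qin(1)[OF i(2)] i(3) by (auto simp: M_partition_in_def)
      then show ?thesis
        using delta_fineD[OF Qin(2)[OF i(2)] i(3)] qD(2)[OF i(2)] by (auto simp: i)
    qed
    have zero: "measure lebesgue (?K i) *\<^sub>R f (?t i) = 0" if "i \<in> A" "interior (?K i) = {}" for i
      using box_familyD(2)[OF Afam that(1)] that(2) measure_box_eq_0 by (metis scaleR_zero_left)
    \<comment> \<open>All the pieces together form one \<delta>-fine partition of \<open>?W\<close>.
      Thus the approximation property of \<delta>, which was fixed before the \<open>P L\<close>
      were chosen, applies to their joint Riemann sum.\<close>
    obtain \<rho> where \<rho>: "M_partition_in ?W \<rho>" "delta_fine \<delta> \<rho>"
      "(\<Sum>(s, I)\<in>\<rho>. measure lebesgue I *\<^sub>R f s) = (\<Sum>i\<in>A. measure lebesgue (?K i) *\<^sub>R f (?t i))"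
      "\<And>u v. (\<Union>i\<in>A. ?K i) = cbox u v \<Longrightarrow> box u v \<noteq> {} \<Longrightarrow> (\<Union>(s, I)\<in>\<rho>. I) = cbox u v"
      by (rule box_family_partition[where t = ?t and \<delta> = \<delta> and
          h = "\<lambda>s I. measure lebesgue I *\<^sub>R f s", OF Afam])
        (erule Asub, erule (1) zero, rule that)
    have "(\<Union>i\<in>A. ?K i) = ?W"
    proof -
      have "(\<Union>i\<in>A. ?K i) = (\<Union>L\<in>q. L \<inter> (\<Union>x\<in>Q L. snd x))" by (auto simp: A_def)
      also have "\<dots> = (\<Union>L\<in>q. L)"
        using Int_absorb2[OF Qcover] by (intro SUP_cong refl)
      finally show ?thesis using qD(6) by simp
    qed
    then have part: "M_partition_of ?W \<rho>"
      using \<rho>(1) \<rho>(4)[OF _ box] unfolding M_partition_of_def by simp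
    define S where "S L = (\<Sum>x\<in>Q L. measure lebesgue (L \<inter> snd x) *\<^sub>R f (fst x))" for L
    have "(\<Sum>(t, I)\<in>\<rho>. measure lebesgue I *\<^sub>R (indicator ?W t *\<^sub>R f t)) =
        (\<Sum>(t, I)\<in>\<rho>. measure lebesgue I *\<^sub>R f t)"
      using \<rho>(1) by (intro sum.cong) (auto simp: M_partition_in_def)
    also have "\<dots> = (\<Sum>L\<in>q. S L)"
      unfolding \<rho>(3) S_def A_def using qD(1) Qfin
      by (subst sum.Sigma) (auto simp: case_prod_unfold)
    finally have "norm ((\<Sum>L\<in>q. S L) - F ?W) < \<epsilon> / 2" using \<delta>(2)[of \<rho>] part \<rho>(2) by simp
    moreover have "F ?W = (\<Sum>L\<in>q. ?G L)"
    proof -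
      interpret operative "(+)" 0 ?G using F by (rule operative_zero_ext)
      show ?thesis using division[OF q(2)] zero_ext_interval[OF WW, of F] by (simp add: sum_def)
    qed
    ultimately have total: "norm (\<Sum>L\<in>q. S L - ?G L) < \<epsilon> / 2" by (simp add: sum_subtractf)
    \<comment> \<open>On a box of \<pi> the quantity \<open>S L - ?G L\<close> is exactly the
      corresponding term of the estimate, so the total error minus the error on the added boxes is
      the sum to be bounded.\<close>
    have "(\<Sum>L\<in>q. S L - ?G L) = (\<Sum>L\<in>q - p. S L - ?G L) + (\<Sum>L\<in>p. S L - ?G L)"
      using qD(1) q(1) by (rule sum.subset_diff[rotated])
    also have "(\<Sum>L\<in>p. S L - ?G L) = (\<Sum>x\<in>\<pi>. S (snd x) - ?G (snd x))"
      unfolding p_def using inj by (subst sum.reindex) (auto simp: inj_on_def)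
    also have "\<dots> = (\<Sum>(t, I)\<in>\<pi>. measure lebesgue I *\<^sub>R f t - F I)"
    proof (rule sum.cong[OF refl])
      fix x assume x: "x \<in> \<pi>"
      have "{y \<in> \<pi>. snd y = snd x} = {x}" using inj x by blast
      then have "Q (snd x) = {x}" using x by (auto simp: Q_def p_def)
      then show "S (snd x) - ?G (snd x) = (case x of (t, I) \<Rightarrow> measure lebesgue I *\<^sub>R f t - F I)"
        using zero_ext_interval[OF \<pi>W(2)[OF x], of F] by (simp add: S_def case_prod_unfold)
    qed
    finally have "(\<Sum>(t, I)\<in>\<pi>. measure lebesgue I *\<^sub>R f t - F I) =
        (\<Sum>L\<in>q. S L - ?G L) - (\<Sum>L\<in>q - p. S L - ?G L)"
      by simp
    moreover have "norm (\<Sum>L\<in>q - p. S L - ?G L) \<le> \<epsilon> / 2"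
    proof -
      have "norm (S L - ?G L) \<le> \<eta>" if "L \<in> q - p" for L
        using P(3)[of L] that by (simp add: S_def Q_def case_prod_unfold)
      then have "norm (\<Sum>L\<in>q - p. S L - ?G L) \<le> (\<Sum>L\<in>q - p. \<eta>)" by (rule sum_norm_le)
      also have "\<dots> \<le> (\<Sum>L\<in>q. \<eta>)"
        using qD(1) \<open>0 < \<eta>\<close> by (intro sum_mono2) auto
      also have "\<dots> \<le> (real (card q) + 1) * \<eta>"
        using \<open>0 < \<eta>\<close> by (simp add: algebra_simps)
      also have "\<dots> = \<epsilon> / 2"
      proof -
        have "real (card q) + 1 \<noteq> 0" by linarith
        then show ?thesis unfolding \<eta>_def by (metis mult.commute nonzero_eq_divide_eq)
      qed
      finally show ?thesis .
    qed
    ultimately show "norm (\<Sum>(t, I)\<in>\<pi>. measure lebesgue I *\<^sub>R f t - F I) < \<epsilon>"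
      using total norm_triangle_ineq4[of "\<Sum>L\<in>q. S L - ?G L" "\<Sum>L\<in>q - p. S L - ?G L"] by simp
  qed
qed

section \<open>Absolute continuity and divisions\<close>

text \<open>Since tags need not lie in their intervals, cutting the intervals of one fixed fine partition
  along the given boxes leaves it fine, and its Riemann sum is bounded by a multiple of their
  measure.\<close>

lemma henstock_absolutely_continuous:
  fixes f :: "real ^ 'm \<Rightarrow> 'x::real_normed_vector"
  assumes W: "cbox a b \<in> intervals" and F: "additive_interval_function (cbox a b) F"
    and hen: "henstock_primitive f (cbox a b) F" and "0 < \<epsilon>"
  obtains \<eta> where "0 < \<eta>"
    "\<And>A (K :: 'i \<Rightarrow> _). box_family A K \<Longrightarrow> \<forall>i\<in>A. K i \<subseteq> cbox a b \<Longrightarrow>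
      (\<Sum>i\<in>A. measure lebesgue (K i)) < \<eta> \<Longrightarrow> norm (\<Sum>i\<in>A. zero_ext (cbox a b) F (K i)) < \<epsilon>"
proof -
  let ?W = "cbox a b"
  let ?G = "zero_ext ?W F"
  obtain \<delta> where \<delta>: "gauge_on ?W \<delta>" "\<And>\<pi>. M_partition_in ?W \<pi> \<Longrightarrow> delta_fine \<delta> \<pi> \<Longrightarrow>
      norm (\<Sum>(t, I)\<in>\<pi>. measure lebesgue I *\<^sub>R f t - F I) < \<epsilon> / 2"
    using hen half_gt_zero[OF \<open>0 < \<epsilon>\<close>] unfolding henstock_primitive_def by meson
  have "box a b \<noteq> {}" using W by (simp add: intervals_iff)
  then obtain \<pi> where \<pi>: "M_partition_of ?W \<pi>" "delta_fine \<delta> \<pi>"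
    by (rule fine_M_partition_exists[OF _ \<delta>(1)])
  then have \<pi>W: "M_partition_in ?W \<pi>" and cover: "(\<Union>x\<in>\<pi>. snd x) = ?W"
    by (auto simp: M_partition_of_def case_prod_unfold)
  have fam: "box_family \<pi> snd" using \<pi>W by (rule M_partition_in_box_family)
  \<comment> \<open>A bound for \<open>f\<close> at the finitely many tags of the fixed partition,
    even if \<open>f\<close> is unbounded; the summand 1 makes it positive.\<close>
  define B where "B = (\<Sum>x\<in>\<pi>. norm (f (fst x))) + 1"
  have B: "norm (f (fst x)) \<le> B" if "x \<in> \<pi>" for x
    using member_le_sum[OF that, of "\<lambda>x. norm (f (fst x))"] box_familyD(1)[OF fam]
    by (simp add: B_def)
  have "0 < B" using sum_nonneg[of \<pi> "\<lambda>x. norm (f (fst x))"] by (simp add: B_def)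
  show ?thesis
  proof (rule that)
    show "0 < \<epsilon> / 2 / B" using \<open>0 < \<epsilon>\<close> \<open>0 < B\<close> by simp
    fix A and K :: "'i \<Rightarrow> (real ^ 'm) set"
    assume K: "box_family A K" and "\<forall>i\<in>A. K i \<subseteq> ?W"
      and small: "(\<Sum>i\<in>A. measure lebesgue (K i)) < \<epsilon> / 2 / B"
    then have KW: "K i \<subseteq> ?W" if "i \<in> A" for i using that by blast
    let ?L = "\<lambda>(i, x). K i \<inter> snd x" and ?t = "\<lambda>(i, x). fst x"
    have L: "box_family (A \<times> \<pi>) ?L" using K fam by (rule box_family_Sigma)
    have splitG: "(\<Sum>x\<in>\<pi>. ?G (K i \<inter> snd x)) = ?G (K i)"
      and splitM: "(\<Sum>x\<in>\<pi>. measure lebesgue (K i \<inter> snd x)) = measure lebesgue (K i)"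
      if i: "i \<in> A" for i
    proof -
      obtain c d where cd: "K i = cbox c d" using box_familyD(2)[OF K i] by blast
      then have "cbox c d \<subseteq> (\<Union>x\<in>\<pi>. snd x)" using KW[OF i] by (simp add: cover)
      from operative_box_family[OF operative_zero_ext[OF F] fam this]
        operative_box_family[OF operative_measure_lebesgue fam this]
      show "(\<Sum>x\<in>\<pi>. ?G (K i \<inter> snd x)) = ?G (K i)"
        and "(\<Sum>x\<in>\<pi>. measure lebesgue (K i \<inter> snd x)) = measure lebesgue (K i)"
        by (simp_all only: cd)
    qed
    have "norm (\<Sum>p\<in>A \<times> \<pi>. measure lebesgue (?L p) *\<^sub>R f (?t p) - ?G (?L p)) < \<epsilon> / 2"
    proof (rule henstock_box_family[OF \<delta>(2) L])
      fix p assume "p \<in> A \<times> \<pi>"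
      then obtain i x where p: "p = (i, x)" "i \<in> A" "x \<in> \<pi>" by blast
      then show "?t p \<in> ?W \<and> ?L p \<subseteq> ?W \<and> ?L p \<subseteq> max_ball (?t p) (\<delta> (?t p))"
        using \<pi>W KW delta_fineD[OF \<pi>(2) p(3)] by (auto simp: M_partition_in_def)
    qed
    moreover have "(\<Sum>p\<in>A \<times> \<pi>. ?G (?L p)) = (\<Sum>i\<in>A. ?G (K i))"
      using splitG
      by (simp add: sum.cartesian_product')
    moreover have "norm (\<Sum>p\<in>A \<times> \<pi>. measure lebesgue (?L p) *\<^sub>R f (?t p)) < \<epsilon> / 2"
    proof -
      have "norm (\<Sum>p\<in>A \<times> \<pi>. measure lebesgue (?L p) *\<^sub>R f (?t p))
          \<le> (\<Sum>p\<in>A \<times> \<pi>. measure lebesgue (?L p) * B)"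
        using B by (intro sum_norm_le) (auto intro: mult_left_mono)
      also have "\<dots> = (\<Sum>p\<in>A \<times> \<pi>. measure lebesgue (?L p)) * B"
        by (rule sum_distrib_right[symmetric])
      also have "(\<Sum>p\<in>A \<times> \<pi>. measure lebesgue (?L p)) = (\<Sum>i\<in>A. measure lebesgue (K i))"
        using splitM
        by (simp add: sum.cartesian_product')
      also have "\<dots> * B < \<epsilon> / 2" using small \<open>0 < B\<close> by (simp add: pos_less_divide_eq)
      finally show ?thesis .
    qed
    ultimately show "norm (\<Sum>i\<in>A. ?G (K i)) < \<epsilon>"
      using norm_triangle_ineq4[of "\<Sum>p\<in>A \<times> \<pi>. measure lebesgue (?L p) *\<^sub>R f (?t p)"
          "\<Sum>p\<in>A \<times> \<pi>. measure lebesgue (?L p) *\<^sub>R f (?t p) - ?G (?L p)"]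
      by (simp add: sum_subtractf)
  qed
qed

section \<open>Unconditional convergence along a division\<close>

text \<open>Completeness turns the Cauchy condition for the net of finite sums into convergence. The
  condition concerns norms of finite tail sums, which is exactly what absolute continuity of
  \<open>F\<close> bounds; sums of norms do not enter.\<close>

lemma summable_on_Cauchy:
  fixes g :: "'i \<Rightarrow> 'x::banach"
  assumes "\<And>\<epsilon>. 0 < \<epsilon> \<Longrightarrow> \<exists>X. finite X \<and> X \<subseteq> A \<and>
    (\<forall>Y. finite Y \<and> Y \<subseteq> A - X \<longrightarrow> norm (sum g Y) < \<epsilon>)"
  shows "g summable_on A"
proof -
  have "cauchy_filter (filtermap (sum g) (finite_subsets_at_top A))"
    unfolding cauchy_filter_metric_filtermap
  proof (intro allI impI)
    fix \<epsilon> :: real assume "0 < \<epsilon>"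
    then obtain X where X: "finite X" "X \<subseteq> A"
      and small: "\<And>Y. finite Y \<Longrightarrow> Y \<subseteq> A - X \<Longrightarrow> norm (sum g Y) < \<epsilon> / 2"
      using assms[OF half_gt_zero] by meson
    have near: "dist (sum g Y) (sum g X) < \<epsilon> / 2" if "finite Y" "X \<subseteq> Y" "Y \<subseteq> A" for Y
    proof -
      have "sum g Y = sum g (Y - X) + sum g X" using that(1,2) by (rule sum.subset_diff[rotated])
      moreover have "norm (sum g (Y - X)) < \<epsilon> / 2" using that by (intro small) auto
      ultimately show ?thesis by (simp add: dist_norm)
    qed
    let ?P = "\<lambda>Y. finite Y \<and> X \<subseteq> Y \<and> Y \<subseteq> A"
    have "eventually ?P (finite_subsets_at_top A)"
      unfolding eventually_finite_subsets_at_top using X by blast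
    moreover have "dist (sum g Y) (sum g Z) < \<epsilon>" if "?P Y" "?P Z" for Y Z
      using near[of Y] near[of Z] that by (meson dist_triangle_half_l)
    ultimately show "\<exists>P. eventually P (finite_subsets_at_top A) \<and>
        (\<forall>Y Z. P Y \<and> P Z \<longrightarrow> dist (sum g Y) (sum g Z) < \<epsilon>)"
      by (intro exI[of _ ?P]) simp
  qed
  moreover have "complete (UNIV :: 'x set)"
    by (meson Cauchy_convergent UNIV_I complete_def convergent_def)
  ultimately obtain s where "(sum g \<longlongrightarrow> s) (finite_subsets_at_top A)"
    using complete_uniform[where S = "UNIV :: 'x set"] by (force simp add: filterlim_def)
  then show ?thesis unfolding summable_on_def has_sum_def by blast
qed

lemma has_sum_finite_near:
  fixes g :: "'i \<Rightarrow> 'x::real_normed_vector"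
  shows "(g has_sum s) A \<longleftrightarrow> (\<forall>\<epsilon>>0. \<exists>X. finite X \<and> X \<subseteq> A \<and>
    (\<forall>Y. finite Y \<and> X \<subseteq> Y \<and> Y \<subseteq> A \<longrightarrow> norm (sum g Y - s) < \<epsilon>))"
  unfolding has_sum_def tendsto_iff eventually_finite_subsets_at_top dist_norm by simp

lemma division_box_family:
  assumes "D \<in> divisions_in E" "finite A"
  shows "box_family A (\<lambda>k. cbox c d \<inter> D k)"
proof (rule box_family_Int_box)
  have "D k \<in> intervals_in E" for k using assms(1) unfolding divisions_in_def by blast
  then have "\<exists>a b. D k = cbox a b" for k using intervals_inD(1) by blast
  moreover have "interior (D j) \<inter> interior (D k) = {}" if "j \<noteq> k" for j k
    using assms(1) that unfolding divisions_in_def nonoverlapping_def by blast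
  ultimately show "box_family A D"
    unfolding box_family_def pairwise_def using assms(2) by blast
qed

lemma division_subset: "D \<in> divisions_in E \<Longrightarrow> D k \<subseteq> E"
  unfolding divisions_in_def intervals_in_def by blast

text \<open>Countable additivity, as the pieces overlap only in null sets. The tails of this
  convergent series supply the families of small measure on which \<open>F\<close> is small.\<close>

lemma division_measure_has_sum:
  assumes D: "D \<in> divisions_in E"
  shows "((\<lambda>k. measure lebesgue (cbox c d \<inter> D k)) has_sum
    measure lebesgue (\<Union>k. cbox c d \<inter> D k)) UNIV"
proof (rule sums_nonneg_imp_has_sum)
  let ?K = "\<lambda>k. cbox c d \<inter> D k"
  have K: "\<exists>u v. ?K k = cbox u v" for k
    using box_familyD(2)[OF division_box_family[OF D, of "{k}"]] by simp
  show "(\<lambda>k. measure lebesgue (?K k)) sums measure lebesgue (\<Union>k. ?K k)"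
  proof (rule measure_countable_negligible_Union_bounded)
    show "?K k \<in> lmeasurable" for k using K[of k] by (metis lmeasurable_cbox)
    have "negligible (?K j \<inter> ?K k)" if "j \<noteq> k" for j k
    proof -
      have "interior (?K j \<inter> ?K k) = {}"
        using box_familyD(3)[OF division_box_family[OF D, of "{j, k}" c d], of j k] that
        by (simp only: interior_Int) simp
      moreover have "convex (?K j \<inter> ?K k)" using K[of j] K[of k] by (metis convex_Int convex_box(1))
      ultimately show ?thesis using negligible_convex_interior by blast
    qed
    then show "pairwise (\<lambda>j k. negligible (?K j \<inter> ?K k)) UNIV" by (simp add: pairwise_def)
    show "bounded (\<Union>k. ?K k)" by (rule bounded_subset[OF bounded_cbox[of c d]]) blast
  qed
qed simp

text \<open>Indices outside \<open>hits\<close> give degenerate intersections, where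
  \<open>zero_ext\<close> is 0; those in \<open>hits\<close> give intervals of the box, where it is
  \<open>F\<close>. The index set can thus be taken to be all natural numbers, independently of the
  interval.\<close>

lemma division_series:
  assumes D: "D \<in> divisions_in (cbox a b)"
  shows "((\<lambda>k. F (cbox c d \<inter> D k)) has_sum s) (hits D (cbox c d)) \<longleftrightarrow>
    ((\<lambda>k. zero_ext (cbox a b) F (cbox c d \<inter> D k)) has_sum s) UNIV"
proof (rule has_sum_cong_neutral)
  have K: "\<exists>u v. cbox c d \<inter> D k = cbox u v" for k
    using box_familyD(2)[OF division_box_family[OF D, of "{k}"]] by simp
  have hit: "k \<in> hits D (cbox c d) \<longleftrightarrow> interior (cbox c d \<inter> D k) \<noteq> {}" for k
    using K[of k] measure_box_eq_0 measure_nonneg[of lebesgue "cbox c d \<inter> D k"]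
    unfolding hits_def by (metis less_le mem_Collect_eq)
  show "zero_ext (cbox a b) F (cbox c d \<inter> D k) = 0" if "k \<in> UNIV - hits D (cbox c d)" for k
    using that hit by (simp add: zero_ext_degenerate del: interior_Int)
  show "F (cbox c d \<inter> D k) = zero_ext (cbox a b) F (cbox c d \<inter> D k)"
    if "k \<in> hits D (cbox c d) \<inter> UNIV" for k
  proof -
    have "cbox c d \<inter> D k \<in> intervals_in (cbox a b)"
      using K hit that division_subset[OF D, of k] by (intro intervals_inI) auto
    then show ?thesis by (simp add: zero_ext_interval)
  qed
qed simp

lemma henstock_series_summable:
  fixes f :: "real ^ 'm \<Rightarrow> 'x::banach"
  assumes W: "cbox a b \<in> intervals" and F: "additive_interval_function (cbox a b) F"
    and hen: "henstock_primitive f (cbox a b) F" and D: "D \<in> divisions_in (cbox a b)"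
  shows "(\<lambda>k. zero_ext (cbox a b) F (cbox c d \<inter> D k)) summable_on UNIV"
proof (rule summable_on_Cauchy)
  let ?K = "\<lambda>k. cbox c d \<inter> D k"
  let ?m = "\<lambda>k. measure lebesgue (?K k)"
  fix \<epsilon> :: real assume "0 < \<epsilon>"
  obtain \<eta> where \<eta>: "0 < \<eta>"
    "\<And>A (K :: nat \<Rightarrow> _). box_family A K \<Longrightarrow> \<forall>i\<in>A. K i \<subseteq> cbox a b \<Longrightarrow>
      (\<Sum>i\<in>A. measure lebesgue (K i)) < \<eta> \<Longrightarrow> norm (\<Sum>i\<in>A. zero_ext (cbox a b) F (K i)) < \<epsilon>"
    by (rule henstock_absolutely_continuous[OF W F hen \<open>0 < \<epsilon>\<close>]) (rule that)
  obtain s where "(?m has_sum s) UNIV" using division_measure_has_sum[OF D] by blast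
  \<comment> \<open>Both \<open>X\<close> and \<open>X \<union> Y\<close> give sums within \<eta> /
    2 of \<open>s\<close>, so the pieces indexed by a set \<open>Y\<close> disjoint from
    \<open>X\<close> have total measure below \<eta>.\<close>
  then obtain X where X: "finite X"
    "\<And>Y. finite Y \<Longrightarrow> X \<subseteq> Y \<Longrightarrow> norm (sum ?m Y - s) < \<eta> / 2"
    unfolding has_sum_finite_near using half_gt_zero[OF \<eta>(1)] by (meson subset_UNIV)
  have "norm (\<Sum>k\<in>Y. zero_ext (cbox a b) F (?K k)) < \<epsilon>" if Y: "finite Y" "Y \<subseteq> UNIV - X" for Y
  proof (rule \<eta>(2))
    show "box_family Y ?K" using D Y(1) by (rule division_box_family)
    show "\<forall>k\<in>Y. ?K k \<subseteq> cbox a b" using division_subset[OF D] by blast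
    have "sum ?m (X \<union> Y) = sum ?m X + sum ?m Y"
      using X(1) Y by (intro sum.union_disjoint) auto
    then show "sum ?m Y < \<eta>"
      using X(2)[of X] X(2)[of "X \<union> Y"] X(1) Y(1) by (simp add: abs_if split: if_splits)
  qed
  then show "\<exists>X. finite X \<and> X \<subseteq> UNIV \<and> (\<forall>Y. finite Y \<and> Y \<subseteq> UNIV - X \<longrightarrow>
      norm (\<Sum>k\<in>Y. zero_ext (cbox a b) F (?K k)) < \<epsilon>)"
    using X(1) by blast
qed

text \<open>\<open>F\<close> is finitely additive, so its value minus a partial sum is the sum of
  \<open>F\<close> over a finite remainder of boxes. The remainder has small measure because the
  series of measures converges to the measure of the box, and absolute continuity makes that sum
  small.\<close>

lemma henstock_series_has_sum:
  fixes f :: "real ^ 'm \<Rightarrow> 'x::real_normed_vector"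
  assumes W: "cbox a b \<in> intervals" and F: "additive_interval_function (cbox a b) F"
    and hen: "henstock_primitive f (cbox a b) F"
    and D: "D \<in> divisions_of (interior (cbox a b))"
  shows "((\<lambda>k. zero_ext (cbox a b) F (cbox c d \<inter> D k)) has_sum zero_ext (cbox a b) F (cbox c d)) UNIV"
  unfolding has_sum_finite_near
proof (intro allI impI)
  let ?G = "zero_ext (cbox a b) F"
  let ?K = "\<lambda>k. cbox c d \<inter> D k"
  let ?m = "\<lambda>k. measure lebesgue (?K k)"
  fix \<epsilon> :: real assume "0 < \<epsilon>"
  have Din: "D \<in> divisions_in (box a b)" and cover: "(\<Union>k. D k) = box a b"
    using D by (auto simp: divisions_of_def)
  \<comment> \<open>The interval may leave \<open>cbox a b\<close>. Clipping it changes neither the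
    intersections with the \<open>D k\<close> nor the \<open>zero_ext\<close> value.\<close>
  obtain u v where uv: "cbox c d \<inter> cbox a b = cbox u v" unfolding Int_interval by blast
  have KK: "?K k = cbox u v \<inter> D k" for k
    using division_subset[OF Din, of k] box_subset_cbox[of a b] by (auto simp: uv[symmetric])
  have G: "?G (cbox c d) = ?G (cbox u v)"
    unfolding zero_ext_def uv[symmetric] by (simp add: Int_assoc)
  obtain \<eta> where \<eta>: "0 < \<eta>"
    "\<And>A (K :: (real ^ 'm) set \<Rightarrow> _). box_family A K \<Longrightarrow> \<forall>i\<in>A. K i \<subseteq> cbox a b \<Longrightarrow>
      (\<Sum>i\<in>A. measure lebesgue (K i)) < \<eta> \<Longrightarrow> norm (\<Sum>i\<in>A. ?G (K i)) < \<epsilon>"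
    by (rule henstock_absolutely_continuous[OF W F hen \<open>0 < \<epsilon>\<close>]) (rule that)
  \<comment> \<open>The \<open>D k\<close> exhaust only the open box; what they miss of
    \<open>cbox u v\<close> lies in the null boundary.\<close>
  have "measure lebesgue (\<Union>k. ?K k) = measure lebesgue (cbox u v)"
  proof -
    have "(\<Union>k. ?K k) = cbox u v \<inter> box a b" using cover KK by auto
    moreover have "cbox u v = (cbox u v \<inter> box a b) \<union> (cbox u v - box a b)" by blast
    moreover have "negligible (cbox u v - box a b)"
      using negligible_frontier_interval[of a b] by (rule negligible_subset) (auto simp: uv[symmetric])
    moreover have "cbox u v \<inter> box a b \<in> sets lebesgue" by simp
    ultimately show ?thesis by (metis measure_Un_null_set negligible_iff_null_sets)
  qed
  then obtain X where X: "finite X"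
    "\<And>Y. finite Y \<Longrightarrow> X \<subseteq> Y \<Longrightarrow> norm (sum ?m Y - measure lebesgue (cbox u v)) < \<eta>"
    using division_measure_has_sum[OF Din, of c d] \<eta>(1)
    unfolding has_sum_finite_near by (metis subset_UNIV)
  have "norm ((\<Sum>k\<in>Y. ?G (?K k)) - ?G (cbox c d)) < \<epsilon>" if Y: "finite Y" "X \<subseteq> Y" for Y
  proof -
    have fam: "box_family Y (\<lambda>k. cbox u v \<inter> D k)" using Din Y(1) by (rule division_box_family)
    obtain R where R: "box_family R (\<lambda>L. L)" "\<And>L. L \<in> R \<Longrightarrow> L \<subseteq> cbox u v"
      "((\<lambda>k. cbox u v \<inter> D k) ` Y - {{}}) \<inter> R = {}"
      "((\<lambda>k. cbox u v \<inter> D k) ` Y - {{}}) \<union> R division_of cbox u v"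
      by (rule box_family_complement[OF fam, of u v]) (auto intro: that)
    have "norm (\<Sum>L\<in>R. ?G L) < \<epsilon>"
    proof (rule \<eta>(2)[OF R(1)])
      show "\<forall>L\<in>R. L \<subseteq> cbox a b" using R(2) uv by blast
      show "(\<Sum>L\<in>R. measure lebesgue L) < \<eta>"
        using X(2)[OF Y] operative_complement[OF operative_measure_lebesgue fam R(3,4)]
        by (simp add: KK)
    qed
    then show ?thesis
      using operative_complement[OF operative_zero_ext[OF F] fam R(3,4)]
      by (simp add: KK G norm_minus_commute)
  qed
  then show "\<exists>X. finite X \<and> X \<subseteq> UNIV \<and> (\<forall>Y. finite Y \<and> X \<subseteq> Y \<and> Y \<subseteq> UNIV \<longrightarrow>
      norm ((\<Sum>k\<in>Y. ?G (?K k)) - ?G (cbox c d)) < \<epsilon>)"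
    using X(1) by blast
qed

lemma divisions_of_mono_in: "D \<in> divisions_of E \<Longrightarrow> E \<subseteq> E' \<Longrightarrow> D \<in> divisions_in E'"
  unfolding divisions_of_def divisions_in_def intervals_in_def by blast

text \<open>With \<open>zero_ext\<close> as the limit, intervals that leave the box are included;
  condition (3) involves such intervals.\<close>

lemma henstock_division_series:
  fixes f :: "real ^ 'm \<Rightarrow> 'x::real_normed_vector"
  assumes W: "cbox a b \<in> intervals" and F: "additive_interval_function (cbox a b) F"
    and hen: "henstock_primitive f (cbox a b) F"
    and D: "D \<in> divisions_of (interior (cbox a b))" and I: "I \<in> intervals"
  shows "((\<lambda>k. F (I \<inter> D k)) has_sum zero_ext (cbox a b) F I) (hits D I)"
proof -
  obtain c d where "I = cbox c d" using I by (auto simp: intervals_iff)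
  then show ?thesis
    using henstock_series_has_sum[OF W F hen D]
      division_series[OF divisions_of_mono_in[OF D interior_subset]] by blast
qed

section \<open>The Dunford property and negligible variation from the estimate\<close>

lemma henstock_imp_dunford:
  fixes f :: "real ^ 'm \<Rightarrow> 'x::banach"
  assumes W: "cbox a b \<in> intervals" and F: "additive_interval_function (cbox a b) F"
    and hen: "henstock_primitive f (cbox a b) F"
  shows "dunford_function (cbox a b) F"
  unfolding dunford_function_def
proof (intro conjI ballI impI F)
  fix D and I :: "(real ^ 'm) set" assume D: "D \<in> divisions_in (cbox a b)"
  show "(\<lambda>k. F (I \<inter> D k)) summable_on hits D I" if "I \<in> intervals"
  proof -
    obtain c d where I: "I = cbox c d" using \<open>I \<in> intervals\<close> by (auto simp: intervals_iff)
    obtain s where "((\<lambda>k. zero_ext (cbox a b) F (cbox c d \<inter> D k)) has_sum s) UNIV"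
      using henstock_series_summable[OF W F hen D] unfolding summable_on_def by blast
    then show ?thesis
      unfolding I division_series[OF D, symmetric] summable_on_def by blast
  qed
  show "F I = (\<Sum>\<^sub>\<infinity>k\<in>hits D I. F (I \<inter> D k))"
    if "D \<in> divisions_of (interior (cbox a b))" "I \<in> intervals_in (cbox a b)"
  proof -
    have "I \<in> intervals" using that(2) by (simp add: intervals_in_def)
    from henstock_division_series[OF W F hen that(1) this] zero_ext_interval[OF that(2), of F]
    show ?thesis by (simp add: infsumI)
  qed
qed

text \<open>Every inner series has a limit that does not depend on the division, namely
  \<open>F\<close> of the clipped interval or 0. Hence one gauge, forcing the intervals into an open
  set of small measure around the boundary, serves all divisions at once.\<close>

lemma henstock_imp_negligible_variation:
  fixes f :: "real ^ 'm \<Rightarrow> 'x::banach"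
  assumes W: "cbox a b \<in> intervals" and F: "additive_interval_function (cbox a b) F"
    and hen: "henstock_primitive f (cbox a b) F"
  shows "M_negligible_variation (cbox a b) F (cbox a b - interior (cbox a b))"
  unfolding M_negligible_variation_def
proof (intro allI impI)
  let ?Z = "cbox a b - interior (cbox a b)"
  let ?G = "zero_ext (cbox a b) F"
  fix \<epsilon> :: real assume "0 < \<epsilon>"
  obtain \<eta> where \<eta>: "0 < \<eta>"
    "\<And>A (K :: (real ^ 'm) \<times> (real ^ 'm) set \<Rightarrow> _). box_family A K \<Longrightarrow> \<forall>i\<in>A. K i \<subseteq> cbox a b \<Longrightarrow>
      (\<Sum>i\<in>A. measure lebesgue (K i)) < \<eta> \<Longrightarrow> norm (\<Sum>i\<in>A. ?G (K i)) < \<epsilon>"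
    by (rule henstock_absolutely_continuous[OF W F hen \<open>0 < \<epsilon>\<close>]) (rule that)
  obtain T where T: "open T" "?Z \<subseteq> T" "T \<in> lmeasurable" "measure lebesgue T < \<eta>"
    using negligible_outer_open[OF negligible_frontier_interval \<eta>(1)] by (metis interior_cbox)
  have "\<exists>r>0. t \<in> ?Z \<longrightarrow> max_ball t r \<subseteq> T" for t
    using max_ball_in_open[OF T(1), of t] T(2) by (meson subset_iff zero_less_one)
  then obtain \<delta> where \<delta>: "\<And>t. 0 < \<delta> t" "\<And>t. t \<in> ?Z \<Longrightarrow> max_ball t (\<delta> t) \<subseteq> T"
    by metis
  show "\<exists>\<delta>. gauge_on ?Z \<delta> \<and>
      (\<forall>\<pi>. M_partition_in UNIV \<pi> \<and> tagged_in ?Z \<pi> \<and> delta_fine \<delta> \<pi> \<longrightarrow>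
        (\<forall>D \<in> divisions_of (interior (cbox a b)).
          (\<forall>(t, I) \<in> \<pi>. (\<lambda>k. F (I \<inter> D k)) summable_on hits D I) \<and>
          norm (\<Sum>(t, I)\<in>\<pi>. \<Sum>\<^sub>\<infinity>k\<in>hits D I. F (I \<inter> D k)) < \<epsilon>))"
  proof (intro exI[of _ \<delta>] conjI allI impI ballI)
    show "gauge_on ?Z \<delta>" using \<delta>(1) by (simp add: gauge_on_def)
    fix \<pi> D assume "M_partition_in UNIV \<pi> \<and> tagged_in ?Z \<pi> \<and> delta_fine \<delta> \<pi>"
      and D: "D \<in> divisions_of (interior (cbox a b))"
    then have \<pi>: "M_partition_in UNIV \<pi>" "tagged_in ?Z \<pi>" "delta_fine \<delta> \<pi>" by auto
    have int: "snd x \<in> intervals" if "x \<in> \<pi>" for x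
      using \<pi>(1) that by (auto simp: M_partition_in_def intervals_in_def)
    note sums = henstock_division_series[OF W F hen D int]
    show "case x of (t, I) \<Rightarrow> (\<lambda>k. F (I \<inter> D k)) summable_on hits D I" if "x \<in> \<pi>" for x
      using sums[OF that] unfolding summable_on_def by (auto simp: case_prod_unfold)
    \<comment> \<open>The intervals are clipped to the box because absolute continuity speaks of
      boxes inside it.\<close>
    have "(\<Sum>(t, I)\<in>\<pi>. \<Sum>\<^sub>\<infinity>k\<in>hits D I. F (I \<inter> D k)) = (\<Sum>x\<in>\<pi>. ?G (cbox a b \<inter> snd x))"
    proof (rule sum.cong[OF refl])
      fix x assume "x \<in> \<pi>"
      have "?G (snd x) = ?G (cbox a b \<inter> snd x)" by (simp add: zero_ext_def Int_ac)
      then show "(case x of (t, I) \<Rightarrow> \<Sum>\<^sub>\<infinity>k\<in>hits D I. F (I \<inter> D k)) = ?G (cbox a b \<inter> snd x)"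
        using infsumI[OF sums[OF \<open>x \<in> \<pi>\<close>]] by (simp add: case_prod_unfold)
    qed
    moreover have "norm (\<Sum>x\<in>\<pi>. ?G (cbox a b \<inter> snd x)) < \<epsilon>"
    proof (rule \<eta>(2))
      show fam: "box_family \<pi> (\<lambda>x. cbox a b \<inter> snd x)"
        by (rule box_family_Int_box[OF M_partition_in_box_family[OF \<pi>(1)]])
      have "cbox a b \<inter> snd x \<subseteq> T" if "x \<in> \<pi>" for x
      proof -
        have "fst x \<in> ?Z" using \<pi>(2) that by (auto simp: tagged_in_def)
        then show ?thesis using \<delta>(2) delta_fineD[OF \<pi>(3) that] by blast
      qed
      then have "(\<Sum>x\<in>\<pi>. measure lebesgue (cbox a b \<inter> snd x)) \<le> measure lebesgue T"
        using T(3) by (intro box_family_measure_le[OF fam])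
      then show "(\<Sum>x\<in>\<pi>. measure lebesgue (cbox a b \<inter> snd x)) < \<eta>" using T(4) by simp
    qed auto
    ultimately show "norm (\<Sum>(t, I)\<in>\<pi>. \<Sum>\<^sub>\<infinity>k\<in>hits D I. F (I \<inter> D k)) < \<epsilon>" by simp
  qed
qed

lemma henstock_primitive_mono:
  assumes "henstock_primitive f W F" "V \<subseteq> W"
  shows "henstock_primitive f V F"
  unfolding henstock_primitive_def
proof (intro allI impI)
  fix \<epsilon> :: real assume "0 < \<epsilon>"
  then obtain \<delta> where \<delta>: "gauge_on W \<delta>" "\<And>\<pi>. M_partition_in W \<pi> \<and> delta_fine \<delta> \<pi> \<Longrightarrow>
      norm (\<Sum>(t, I)\<in>\<pi>. measure lebesgue I *\<^sub>R f t - F I) < \<epsilon>"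
    using assms(1) unfolding henstock_primitive_def by meson
  have "gauge_on V \<delta>" using \<delta>(1) assms(2) by (auto simp: gauge_on_def)
  then show "\<exists>\<delta>. gauge_on V \<delta> \<and> (\<forall>\<pi>. M_partition_in V \<pi> \<and> delta_fine \<delta> \<pi> \<longrightarrow>
      norm (\<Sum>(t, I)\<in>\<pi>. measure lebesgue I *\<^sub>R f t - F I) < \<epsilon>)"
    using \<delta>(2) M_partition_in_mono[OF _ assms(2)] by blast
qed

text \<open>Part (b) of the Dunford property and condition (3) quantify over divisions of the open
  box, so information about \<open>F\<close> can be drawn from them only once such a division is at
  hand.\<close>

lemma division_of_open_box_exists:
  fixes a b :: "real ^ 'm"
  assumes "box a b \<noteq> {}"
  obtains D where "D \<in> divisions_of (box a b)"
proof -
  \<comment> \<open>Each box of the covering lemma lies in the gauge set of one of its points inside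
    \<open>box a b\<close>; this gauge therefore confines it to \<open>box a b\<close>.\<close>
  have "gauge (\<lambda>x. if x \<in> box a b then box a b else UNIV)" by (auto simp: gauge_def)
  then obtain \<D> where \<D>: "countable \<D>" "\<And>K. K \<in> \<D> \<Longrightarrow> interior K \<noteq> {} \<and> (\<exists>c d. K = cbox c d)"
    "pairwise (\<lambda>A B. interior A \<inter> interior B = {}) \<D>"
    "\<And>K. K \<in> \<D> \<Longrightarrow> \<exists>x\<in>box a b \<inter> K. K \<subseteq> (if x \<in> box a b then box a b else UNIV)"
    "box a b \<subseteq> \<Union>\<D>"
    by (rule covering_lemma[OF box_subset_cbox[of a b] assms]) (rule that)
  have sub: "K \<subseteq> box a b" if "K \<in> \<D>" for K using \<D>(4)[OF that] by auto
  then have un: "\<Union>\<D> = box a b" using \<D>(5) by blast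
  \<comment> \<open>A division is a sequence of pairwise non-overlapping intervals, so an injective
    enumeration by all natural numbers is required. A finite union of compact boxes would make the
    open box closed as well, hence the whole space, which is unbounded.\<close>
  have "infinite \<D>"
  proof
    assume "finite \<D>"
    moreover have "compact K" if "K \<in> \<D>" for K using \<D>(2)[OF that] compact_cbox by metis
    ultimately have "compact (\<Union>\<D>)" by (rule compact_Union)
    then have "closed (box a b)" unfolding un by (rule compact_imp_closed)
    then have "box a b = UNIV"
      using clopen[of "box a b"] assms by (simp add: open_box)
    then show False using bounded_box[of a b] not_bounded_UNIV by metis
  qed
  let ?D = "from_nat_into \<D>"
  have bij: "bij_betw ?D UNIV \<D>" using \<D>(1) \<open>infinite \<D>\<close> by (rule bij_betw_from_nat_into)
  have in\<D>: "?D k \<in> \<D>" for k using bij by (auto simp: bij_betw_def)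
  have "?D k \<in> intervals_in (box a b)" for k
    using \<D>(2)[OF in\<D>] sub[OF in\<D>] by (intro intervals_inI) auto
  moreover have "nonoverlapping (?D j) (?D k)" if "j \<noteq> k" for j k
  proof -
    have "?D j \<noteq> ?D k" using bij that by (auto simp: bij_betw_def inj_on_def)
    then show ?thesis using \<D>(3) in\<D> unfolding nonoverlapping_def pairwise_def by blast
  qed
  moreover have "(\<Union>k. ?D k) = box a b" using bij un by (auto simp: bij_betw_def)
  ultimately have "?D \<in> divisions_of (box a b)" unfolding divisions_of_def divisions_in_def by blast
  then show ?thesis by (rule that)
qed

section \<open>The characterization\<close>

lemma henstock_from_interior:
  fixes f :: "real ^ 'm \<Rightarrow> 'x::banach"
  assumes W: "cbox a b \<in> intervals" and hen: "henstock_primitive f (interior (cbox a b)) F"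
    and dun: "dunford_function (cbox a b) F"
    and neg: "M_negligible_variation (cbox a b) F (cbox a b - interior (cbox a b))"
  shows "henstock_primitive f (cbox a b) F"
  unfolding henstock_primitive_def
proof (intro allI impI)
  let ?W = "cbox a b" and ?O = "interior (cbox a b)"
  let ?Z = "?W - ?O"
  fix \<epsilon> :: real assume "0 < \<epsilon>"
  then have \<epsilon>3: "0 < \<epsilon> / 3" by simp
  obtain D where D: "D \<in> divisions_of ?O"
    using division_of_open_box_exists[of a b] W by (auto simp: intervals_iff)
  \<comment> \<open>For one fixed division, part (b) of the Dunford property turns the bound on
    series in condition (3) into a bound on \<open>F\<close> itself.\<close>
  have FD: "F I = (\<Sum>\<^sub>\<infinity>k\<in>hits D I. F (I \<inter> D k))" if "I \<in> intervals_in ?W" for I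
    using dun that D divisions_of_mono_in[OF D interior_subset]
    unfolding dunford_function_def by blast
  obtain \<delta>1 where \<delta>1: "gauge_on ?O \<delta>1" "\<And>\<pi>. M_partition_in ?O \<pi> \<and> delta_fine \<delta>1 \<pi> \<Longrightarrow>
      norm (\<Sum>(t, I)\<in>\<pi>. measure lebesgue I *\<^sub>R f t - F I) < \<epsilon> / 3"
    using hen \<epsilon>3 unfolding henstock_primitive_def by meson
  obtain \<delta>2 where \<delta>2: "gauge_on ?Z \<delta>2"
    "\<And>\<pi>. M_partition_in UNIV \<pi> \<and> tagged_in ?Z \<pi> \<and> delta_fine \<delta>2 \<pi> \<Longrightarrow>
      norm (\<Sum>(t, I)\<in>\<pi>. \<Sum>\<^sub>\<infinity>k\<in>hits D I. F (I \<inter> D k)) < \<epsilon> / 3"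
    using neg \<epsilon>3 D unfolding M_negligible_variation_def by meson
  have "negligible ?Z" using negligible_frontier_interval by simp
  then obtain \<delta>3 where \<delta>3: "\<And>t. 0 < \<delta>3 t"
    "\<And>\<pi>. M_partition_in UNIV \<pi> \<Longrightarrow> tagged_in ?Z \<pi> \<Longrightarrow> delta_fine \<delta>3 \<pi> \<Longrightarrow>
      (\<Sum>(t, I)\<in>\<pi>. measure lebesgue I * norm (f t)) < \<epsilon> / 3"
    using negligible_gauge[OF _ \<epsilon>3, of ?Z f] by metis
  have "\<exists>r>0. t \<in> ?O \<longrightarrow> max_ball t r \<subseteq> ?O" for t
    using max_ball_in_open[OF open_interior, of t ?W] zero_less_one by blast
  then obtain r where r: "\<And>t. 0 < r t" "\<And>t. t \<in> ?O \<Longrightarrow> max_ball t (r t) \<subseteq> ?O" by metis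
  \<comment> \<open>At interior tags \<open>r\<close> keeps the interval in the interior, where
    condition (1) applies. At boundary tags \<open>\<delta>2\<close> controls the sum of
    \<open>F\<close> and \<open>\<delta>3\<close> the Riemann sum. These are the three contributions
    of \<epsilon> / 3.\<close>
  define \<delta> where "\<delta> t = (if t \<in> ?O then min (\<delta>1 t) (r t) else min (\<delta>2 t) (\<delta>3 t))" for t
  show "\<exists>\<delta>. gauge_on ?W \<delta> \<and> (\<forall>\<pi>. M_partition_in ?W \<pi> \<and> delta_fine \<delta> \<pi> \<longrightarrow>
      norm (\<Sum>(t, I)\<in>\<pi>. measure lebesgue I *\<^sub>R f t - F I) < \<epsilon>)"
  proof (intro exI[of _ \<delta>] conjI allI impI)
    show "gauge_on ?W \<delta>"
      using \<delta>1(1) \<delta>2(1) \<delta>3(1) r(1) by (auto simp: gauge_on_def \<delta>_def)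
    fix \<pi> assume "M_partition_in ?W \<pi> \<and> delta_fine \<delta> \<pi>"
    then have \<pi>: "M_partition_in ?W \<pi>" "delta_fine \<delta> \<pi>" by auto
    define \<rho> \<sigma> where "\<rho> = {x \<in> \<pi>. fst x \<in> ?O}" and "\<sigma> = {x \<in> \<pi>. fst x \<in> ?Z}"
    have sub: "\<rho> \<subseteq> \<pi>" "\<sigma> \<subseteq> \<pi>" by (auto simp: \<rho>_def \<sigma>_def)
    have fin: "finite \<pi>" using \<pi>(1) by (simp add: M_partition_in_def)
    have fst_W: "fst x \<in> ?W" if "x \<in> \<pi>" for x using \<pi>(1) that by (auto simp: M_partition_in_def)
    have eq: "\<pi> = \<rho> \<union> \<sigma>" "\<rho> \<inter> \<sigma> = {}" using fst_W unfolding \<rho>_def \<sigma>_def by blast+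
    let ?h = "\<lambda>(t, I). measure lebesgue I *\<^sub>R f t - F I"
    have "norm (sum ?h \<rho>) < \<epsilon> / 3"
    proof (intro \<delta>1(2) conjI)
      have fine: "snd x \<subseteq> max_ball (fst x) (min (\<delta>1 (fst x)) (r (fst x)))" if "x \<in> \<rho>" for x
        using delta_fineD[OF \<pi>(2), of x] that by (auto simp: \<rho>_def \<delta>_def)
      have "snd x \<subseteq> ?O" if "x \<in> \<rho>" for x
      proof -
        have "fst x \<in> ?O" using that by (simp add: \<rho>_def)
        then show ?thesis
          using fine[OF that] r(2) max_ball_mono[OF min.cobounded2[of "\<delta>1 (fst x)" "r (fst x)"]]
          by blast
      qed
      then show "M_partition_in ?O \<rho>"
        using M_partition_in_restrict[OF M_partition_in_subset[OF \<pi>(1) sub(1)], of ?O]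
        by (simp add: \<rho>_def)
      show "delta_fine \<delta>1 \<rho>"
        using delta_fine_subset[OF \<pi>(2) sub(1)]
        by (rule delta_fine_mono) (auto simp: \<rho>_def \<delta>_def)
    qed
    moreover have \<sigma>: "M_partition_in UNIV \<sigma>" "tagged_in ?Z \<sigma>" "delta_fine \<delta>2 \<sigma>" "delta_fine \<delta>3 \<sigma>"
    proof -
      show "M_partition_in UNIV \<sigma>"
        using M_partition_in_mono[OF M_partition_in_subset[OF \<pi>(1) sub(2)]] by simp
      show "tagged_in ?Z \<sigma>" by (auto simp: tagged_in_def \<sigma>_def)
      show "delta_fine \<delta>2 \<sigma>" "delta_fine \<delta>3 \<sigma>"
        using delta_fine_subset[OF \<pi>(2) sub(2)]
        by (rule delta_fine_mono; auto simp: \<sigma>_def \<delta>_def)+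
    qed
    moreover have "norm (\<Sum>(t, I)\<in>\<sigma>. measure lebesgue I *\<^sub>R f t) < \<epsilon> / 3"
    proof -
      have "norm (\<Sum>(t, I)\<in>\<sigma>. measure lebesgue I *\<^sub>R f t) \<le>
          (\<Sum>(t, I)\<in>\<sigma>. measure lebesgue I * norm (f t))"
        by (intro sum_norm_le) auto
      then show ?thesis using \<delta>3(2)[OF \<sigma>(1,2,4)] by simp
    qed
    moreover have "norm (\<Sum>(t, I)\<in>\<sigma>. F I) < \<epsilon> / 3"
    proof -
      have "I \<in> intervals_in ?W" if "(t, I) \<in> \<sigma>" for t I
        using \<pi>(1) sub(2) that unfolding M_partition_in_def by blast
      then have "(\<Sum>(t, I)\<in>\<sigma>. F I) = (\<Sum>(t, I)\<in>\<sigma>. \<Sum>\<^sub>\<infinity>k\<in>hits D I. F (I \<inter> D k))"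
        using FD by (intro sum.cong refl) auto
      then show ?thesis using \<delta>2(2)[of \<sigma>] \<sigma>(1-3) by simp
    qed
    moreover have split: "sum ?h \<pi> = sum ?h \<rho> + ((\<Sum>(t, I)\<in>\<sigma>. measure lebesgue I *\<^sub>R f t) - (\<Sum>(t, I)\<in>\<sigma>. F I))"
    proof -
      have "sum ?h \<pi> = sum ?h \<rho> + sum ?h \<sigma>"
        unfolding eq(1) using fin sub finite_subset eq(2) by (intro sum.union_disjoint) auto
      then show ?thesis by (simp add: case_prod_unfold sum_subtractf)
    qed
    ultimately show "norm (sum ?h \<pi>) < \<epsilon>"
      unfolding split
      using norm_triangle_ineq[of "sum ?h \<rho>"
          "(\<Sum>(t, I)\<in>\<sigma>. measure lebesgue I *\<^sub>R f t) - (\<Sum>(t, I)\<in>\<sigma>. F I)"]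
        norm_triangle_ineq4[of "\<Sum>(t, I)\<in>\<sigma>. measure lebesgue I *\<^sub>R f t" "\<Sum>(t, I)\<in>\<sigma>. F I"]
      by linarith
  qed
qed

theorem theorem3p5:
  fixes f :: "real ^ 'm \<Rightarrow> 'x::banach"
    and F :: "(real ^ 'm) set \<Rightarrow> 'x"
    and I0 :: "(real ^ 'm) set"
  assumes "I0 \<in> intervals"
    and "additive_interval_function I0 F"
  shows "mcshane_integrable_with_primitive f I0 F \<longleftrightarrow>
    (\<forall>\<epsilon>>0. \<exists>\<delta>. gauge_on (interior I0) \<delta> \<and>
       (\<forall>\<pi>. M_partition_in (interior I0) \<pi> \<and> delta_fine \<delta> \<pi> \<longrightarrow>
          norm (\<Sum>(t, I)\<in>\<pi>. measure lebesgue I *\<^sub>R f t - F I) < \<epsilon>)) \<and>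
    dunford_function I0 F \<and>
    M_negligible_variation I0 F (I0 - interior I0)"
proof -
  obtain a b where I0: "I0 = cbox a b" using assms(1) unfolding intervals_iff by blast
  have W: "cbox a b \<in> intervals" and F: "additive_interval_function (cbox a b) F"
    using assms by (simp_all add: I0)
  have "mcshane_integrable_with_primitive f I0 F \<longleftrightarrow> henstock_primitive f I0 F"
    unfolding I0 using primitive_imp_henstock[OF W F] henstock_imp_primitive[OF W F] by blast
  \<comment> \<open>The first conjunct unfolds to condition (1); it follows from the estimate on
    \<open>I0\<close> by restriction to partitions in the interior.\<close>
  also have "\<dots> \<longleftrightarrow> henstock_primitive f (interior I0) F \<and> dunford_function I0 F \<and>
      M_negligible_variation I0 F (I0 - interior I0)"
    unfolding I0
    using henstock_primitive_mono[OF _ interior_subset] henstock_imp_dunford[OF W F]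
      henstock_imp_negligible_variation[OF W F] henstock_from_interior[OF W] by blast
  finally show ?thesis unfolding henstock_primitive_def[of f "interior I0"] .
qed

end
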